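(* Let $X \subseteq \mathbb{Z}^d$ be a finite, lattice-convex and full-dimensional set. If $\mathrm{rc}_\ell(X) = \mathrm{rc}_{\mathbb{Q}}(X)$, then there is a finite algorithm that computes $\mathrm{rc}(X)$.
   Context: A set $X \subseteq \mathbb{Z}^d$ is lattice-convex if $\mathrm{conv}(X) \cap \mathbb{Z}^d = X$. $\mathrm{rc}(X)$ (resp. $\mathrm{rc}_{\mathbb{Q}}(X)$) is the smallest number of facets of a polyhedron (resp. rational polyhedron) $P \subseteq \mathbb{R}^d$ with $P \cap \mathbb{Z}^d = X$. For $Y \subseteq \mathbb{Z}^d$, $\mathrm{rc}(X,Y)$ is the smallest number of inequalities in a linear system $Ax \le b$ satisfied by all points of $X$ and such that each point of $Y \setminus X$ violates at least one inequality. With $B_t = [-t,t]^d \cap \mathbb{Z}^d$, $\mathrm{rc}_\ell(X) = \max_{t \in \mathbb{Z}_{>0}} \mathrm{rc}(X,B_t)$. *)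

theory Defs
  imports "HOL-Analysis.Analysis" "HOL-Library.Nat_Bijection"
begin

definition int_lattice :: "(real^'n) set" where
  "int_lattice = {x. \<forall>i. x $ i \<in> \<int>}"

definition lattice_convex :: "(real^'n) set \<Rightarrow> bool" where
  "lattice_convex X \<longleftrightarrow> convex hull X \<inter> int_lattice = X"

definition rational_polyhedron :: "(real^'n) set \<Rightarrow> bool" where
  "rational_polyhedron P \<longleftrightarrow>
     (\<exists>S :: ((real^'n) \<times> real) set. finite S \<and>
        (\<forall>(a,b)\<in>S. (\<forall>i. a $ i \<in> \<rat>) \<and> b \<in> \<rat>) \<and>
        P = {x. \<forall>(a,b)\<in>S. a \<bullet> x \<le> b})"

definition num_facets :: "(real^'n) set \<Rightarrow> nat" where
  "num_facets P = card {F. F facet_of P}"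

definition rc :: "(real^'n) set \<Rightarrow> nat" where
  "rc X = (LEAST k. \<exists>P. polyhedron P \<and> P \<inter> int_lattice = X \<and> num_facets P = k)"

definition rc_Q :: "(real^'n) set \<Rightarrow> nat" where
  "rc_Q X = (LEAST k. \<exists>P. rational_polyhedron P \<and> P \<inter> int_lattice = X \<and> num_facets P = k)"

definition rc_rel :: "(real^'n) set \<Rightarrow> (real^'n) set \<Rightarrow> nat" where
  "rc_rel X Y = (LEAST k. \<exists>S :: ((real^'n) \<times> real) set. finite S \<and> card S = k \<and>
      (\<forall>x\<in>X. \<forall>(a,b)\<in>S. a \<bullet> x \<le> b) \<and>
      (\<forall>y\<in>Y - X. \<exists>(a,b)\<in>S. a \<bullet> y > b))"

definition box :: "nat \<Rightarrow> (real^'n) set" where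
  "box t = {x \<in> int_lattice. \<forall>i. \<bar>x $ i\<bar> \<le> real t}"

definition rc_l :: "(real^'n) set \<Rightarrow> nat" where
  "rc_l X = Sup {rc_rel X (box t) | t. t > 0}"

datatype recf = Zf | Sf | Idf nat | Cnf recf "recf list" | Prf recf recf | Mnf recf

inductive evalf :: "recf \<Rightarrow> nat list \<Rightarrow> nat \<Rightarrow> bool" where
  zero: "evalf Zf xs 0"
| succ: "evalf Sf (x # xs) (Suc x)"
| proj: "i < length xs \<Longrightarrow> evalf (Idf i) xs (xs ! i)"
| comp: "list_all2 (\<lambda>g y. evalf g xs y) gs ys \<Longrightarrow> evalf f ys r \<Longrightarrow> evalf (Cnf f gs) xs r"
| pr0: "evalf f xs r \<Longrightarrow> evalf (Prf f g) (0 # xs) r"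
| prS: "evalf (Prf f g) (k # xs) r \<Longrightarrow> evalf g (k # r # xs) r' \<Longrightarrow> evalf (Prf f g) (Suc k # xs) r'"
| mu: "evalf f (r # xs) 0 \<Longrightarrow> (\<forall>i<r. \<exists>y. evalf f (i # xs) (Suc y)) \<Longrightarrow> evalf (Mnf f) xs r"

definition encode_points :: "int list list \<Rightarrow> nat" where
  "encode_points xs = list_encode (map (\<lambda>v. list_encode (map int_encode v)) xs)"

definition vec_of :: "('n \<Rightarrow> nat) \<Rightarrow> int list \<Rightarrow> real^'n" where
  "vec_of ord v = (\<chi> i. real_of_int (v ! ord i))"

end

theory Submission
  imports Defs
begin

text \<open>
  Since rc(X, B_t) \<le> rc(X) \<le> rc_Q(X) for every t, the hypothesis forces rc(X) = rc_Q(X) = rc(X, B_t) for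
  some t. Both halves of "rc(X) = k" then have finite certificates over the integers, and the
  algorithm is an unbounded search for a pair of them. The upper bound is certified by k integer
  inequalities that separate X from the lattice points of a large box, together with Farkas multipliers
  confining their solution set to that box: a rational system whose set of lattice points is finite and
  nonempty has no real recession direction, for simultaneous Diophantine approximation would turn
  one into an integral recession direction. The lower bound rc(X, B_t) \<ge> k is certified by refuting
  every partition of the points of B_t outside X into k - 1 classes: in each of them the convex hull of
  some class meets conv X, and again by Diophantine approximation the convex combinations
  witnessing this can be taken rational.
\<close>

section \<open>Recursive functions of one argument\<close>

text \<open>Certificates have unknown size, but each step of the search may only run a terminating
  test. So all their entries are digits of numbers bounded in terms of a single parameter
  \<open>W\<close>, every quantifier becomes bounded, and completeness is proved for all
  sufficiently large \<open>W\<close>, which lets the two halves share one value. Separation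
  theorems deliver real multipliers and real weights. They are made integral by one rounding
  principle for homogeneous integer systems: a value that is an integer and less than 1 is at most
  0. Inhomogeneous data, such as a denominator or the condition that weights sum to 1, is brought
  into this form by an additional unknown or by asking only for equal positive totals. A further gap
  lies between \<open>rc\<close>, which counts facets, and the certificates, which count
  inequalities. As \<open>X\<close> is full-dimensional, every polyhedron containing it has interior
  points, and then a smallest system has exactly one inequality per facet.\<close>

definition rcf :: "nat \<Rightarrow> (nat list \<Rightarrow> nat) \<Rightarrow> bool" where
  "rcf n f \<longleftrightarrow> (\<exists>p. \<forall>xs. length xs = n \<longrightarrow> evalf p xs (f xs))"

lemma rcf_zero: "rcf n (\<lambda>xs. 0)"
  unfolding rcf_def by (auto intro: evalf.zero)

lemma rcf_nth: "i < n \<Longrightarrow> rcf n (\<lambda>xs. xs ! i)"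
  unfolding rcf_def by (auto intro: evalf.proj)

text \<open>In \<open>rcf_rec\<close> the step function sees its parameters as
  \<open>drop 2 ys\<close>; this rule resolves with that form directly.\<close>

lemma rcf_drop_nth: "m + i < n \<Longrightarrow> rcf n (\<lambda>xs. drop m xs ! i)"
  unfolding rcf_def by (rule exI[of _ "Idf (m + i)"]) (auto intro: evalf.proj)

lemma rcf_Suc:
  assumes "rcf n f"
  shows "rcf n (\<lambda>xs. Suc (f xs))"
proof -
  obtain p where "\<And>xs. length xs = n \<Longrightarrow> evalf p xs (f xs)"
    using assms unfolding rcf_def by blast
  then have "evalf (Cnf Sf [p]) xs (Suc (f xs))" if "length xs = n" for xs
    using that by (intro evalf.comp[of _ _ "[f xs]"]) (auto intro: evalf.succ)
  then show ?thesis unfolding rcf_def by blast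
qed

lemma rcf_comp1:
  assumes "rcf 1 (\<lambda>ys. F (ys ! 0))" "rcf n f"
  shows "rcf n (\<lambda>xs. F (f xs))"
proof -
  obtain P where P: "\<And>xs. length xs = 1 \<Longrightarrow> evalf P xs (F (xs ! 0))"
    using assms(1) unfolding rcf_def by blast
  obtain p where p: "\<And>xs. length xs = n \<Longrightarrow> evalf p xs (f xs)"
    using assms(2) unfolding rcf_def by blast
  have "evalf (Cnf P [p]) xs (F (f xs))" if "length xs = n" for xs
    using p that P[of "[f xs]"] by (intro evalf.comp[of _ _ "[f xs]"]) auto
  then show ?thesis unfolding rcf_def by blast
qed

lemma rcf_comp2:
  assumes "rcf 2 (\<lambda>ys. F (ys ! 0) (ys ! 1))" "rcf n f" "rcf n g"
  shows "rcf n (\<lambda>xs. F (f xs) (g xs))"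
proof -
  obtain P where P: "\<And>xs. length xs = 2 \<Longrightarrow> evalf P xs (F (xs ! 0) (xs ! 1))"
    using assms(1) unfolding rcf_def by blast
  obtain p where p: "\<And>xs. length xs = n \<Longrightarrow> evalf p xs (f xs)"
    using assms(2) unfolding rcf_def by blast
  obtain q where q: "\<And>xs. length xs = n \<Longrightarrow> evalf q xs (g xs)"
    using assms(3) unfolding rcf_def by blast
  have "evalf (Cnf P [p, q]) xs (F (f xs) (g xs))" if "length xs = n" for xs
    using p q that P[of "[f xs, g xs]"] by (intro evalf.comp[of _ _ "[f xs, g xs]"]) auto
  then show ?thesis unfolding rcf_def by blast
qed

text \<open>\<open>Prf\<close> recurses on the first entry of its argument list. To let the
  recursion depth be any function of \<open>xs\<close>, that depth is computed first and put in
  front of a copy of \<open>xs\<close> made from projections.\<close>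

lemma rcf_rec:
  assumes "rcf n b" "rcf n a" "rcf (Suc (Suc n)) (\<lambda>ys. g (ys ! 0) (ys ! 1) (drop 2 ys))"
  shows "rcf n (\<lambda>xs. rec_nat (a xs) (\<lambda>k r. g k r xs) (b xs))"
proof -
  obtain pb where pb: "\<And>xs. length xs = n \<Longrightarrow> evalf pb xs (b xs)"
    using assms(1) unfolding rcf_def by blast
  obtain pa where pa: "\<And>xs. length xs = n \<Longrightarrow> evalf pa xs (a xs)"
    using assms(2) unfolding rcf_def by blast
  obtain pg where pg: "\<And>xs. length xs = Suc (Suc n) \<Longrightarrow> evalf pg xs (g (xs ! 0) (xs ! 1) (drop 2 xs))"
    using assms(3) unfolding rcf_def by blast
  have rec: "evalf (Prf pa pg) (k # xs) (rec_nat (a xs) (\<lambda>k r. g k r xs) k)" if "length xs = n" for xs k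
  proof (induction k)
    case 0
    then show ?case using pa[OF that] by (auto intro: evalf.pr0)
  next
    case (Suc k)
    then show ?case
      using pg[of "k # rec_nat (a xs) (\<lambda>k r. g k r xs) k # xs"] that
      by (auto intro: evalf.prS)
  qed
  have "evalf (Cnf (Prf pa pg) (pb # map Idf [0..<n])) xs (rec_nat (a xs) (\<lambda>k r. g k r xs) (b xs))"
    if "length xs = n" for xs
  proof -
    have "list_all2 (\<lambda>g y. evalf g xs y) (map Idf [0..<n]) xs"
      using that by (auto simp: list_all2_conv_all_nth intro!: evalf.proj)
    then show ?thesis
      using that pb rec[OF that] by (intro evalf.comp[of _ _ "b xs # xs"]) auto
  qed
  then show ?thesis unfolding rcf_def by blast
qed

lemma rcf_add:
  assumes "rcf n f" "rcf n g"
  shows "rcf n (\<lambda>xs. f xs + g xs)"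
proof (rule rcf_comp2[where F = "(+)", OF _ assms])
  have eq: "x + y = rec_nat y (\<lambda>k r. Suc r) x" for x y :: nat
    by (induction x) auto
  show "rcf 2 (\<lambda>ys. ys ! 0 + ys ! 1)"
    unfolding eq by (intro rcf_rec rcf_Suc rcf_nth) auto
qed

lemma rcf_mult:
  assumes "rcf n f" "rcf n g"
  shows "rcf n (\<lambda>xs. f xs * g xs)"
proof (rule rcf_comp2[where F = "(*)", OF _ assms])
  have eq: "x * y = rec_nat 0 (\<lambda>k r. r + y) x" for x y :: nat
    by (induction x) auto
  show "rcf 2 (\<lambda>ys. ys ! 0 * ys ! 1)"
    unfolding eq by (intro rcf_rec rcf_add rcf_zero rcf_nth rcf_drop_nth) auto
qed

lemma rcf_diff:
  assumes "rcf n f" "rcf n g"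
  shows "rcf n (\<lambda>xs. f xs - g xs)"
proof (rule rcf_comp2[where F = "(-)", OF _ assms])
  have pred: "rcf n (\<lambda>xs. f xs - 1)" if "rcf n f" for n f
  proof (rule rcf_comp1[OF _ that])
    have eq: "x - 1 = rec_nat 0 (\<lambda>k r. k) x" for x :: nat
      by (cases x) auto
    show "rcf 1 (\<lambda>ys. ys ! 0 - 1)"
      unfolding eq by (intro rcf_rec rcf_zero rcf_nth) auto
  qed
  \<comment> \<open>Truncated subtraction is iterated predecessor. The equation is oriented towards
    the difference, because in the other direction it would also rewrite the \<open>r - 1\<close>
    under the recursion.\<close>
  have eq: "rec_nat x (\<lambda>k r. r - 1) y = x - y" for x y :: nat
    by (induction y) auto
  have "rcf 2 (\<lambda>ys. rec_nat (ys ! 0) (\<lambda>k r. r - 1) (ys ! 1))"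
    by (intro rcf_rec pred rcf_nth) auto
  then show "rcf 2 (\<lambda>ys. ys ! 0 - ys ! 1)"
    unfolding eq .
qed

lemma rcf_const: "rcf n (\<lambda>xs. c)"
  by (induction c) (auto intro: rcf_zero rcf_Suc)

section \<open>Inverting the Cantor pairing function\<close>

definition pfst :: "nat \<Rightarrow> nat" where "pfst z = fst (prod_decode z)"
definition psnd :: "nat \<Rightarrow> nat" where "psnd z = snd (prod_decode z)"
abbreviation pair :: "nat \<Rightarrow> nat \<Rightarrow> nat" where "pair x y \<equiv> prod_encode (x, y)"

lemma pfst_pair [simp]: "pfst (pair x y) = x" and psnd_pair [simp]: "psnd (pair x y) = y"
  by (simp_all add: pfst_def psnd_def)

lemma rcf_triangle:
  assumes "rcf n f"
  shows "rcf n (\<lambda>xs. triangle (f xs))"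
proof (rule rcf_comp1[where F = triangle, OF _ assms])
  have eq: "triangle x = rec_nat 0 (\<lambda>k r. r + Suc k) x" for x
    by (induction x) auto
  show "rcf 1 (\<lambda>ys. triangle (ys ! 0))"
    unfolding eq by (intro rcf_rec rcf_zero rcf_add rcf_Suc rcf_nth) auto
qed

lemma rcf_pair: "rcf n f \<Longrightarrow> rcf n g \<Longrightarrow> rcf n (\<lambda>xs. pair (f xs) (g xs))"
  unfolding prod_encode_def by (simp add: rcf_add rcf_triangle)

text \<open>The sum of the two components of the pair coded by z, computed by recursion on z.\<close>

definition diag_sum :: "nat \<Rightarrow> nat" where
  "diag_sum = rec_nat 0 (\<lambda>z s. s + (1 - (triangle (Suc s) - Suc z)))"

text \<open>The pairs with component sum s have the codes from \<open>triangle s\<close> up to, but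
  excluding, \<open>triangle (Suc s)\<close>. The recursion thus raises s exactly when
  \<open>Suc z\<close> reaches the next triangular number, and the offset of z on its diagonal is
  the first component.\<close>

lemma diag_sum_bounds: "triangle (diag_sum z) \<le> z \<and> z < triangle (Suc (diag_sum z))"
proof (induction z)
  case (Suc z)
  then show ?case
    by (cases "triangle (Suc (diag_sum z)) \<le> Suc z") (auto simp: diag_sum_def)
qed (simp add: diag_sum_def)

lemma pfst_psnd_diag_sum:
  "pfst z = z - triangle (diag_sum z)" "psnd z = diag_sum z - (z - triangle (diag_sum z))"
proof -
  define x where "x = z - triangle (diag_sum z)"
  have "x \<le> diag_sum z" "z = triangle (diag_sum z) + x"
    using diag_sum_bounds[of z] by (auto simp: x_def)
  then have "z = pair x (diag_sum z - x)"
    by (simp add: prod_encode_def)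
  then show "pfst z = z - triangle (diag_sum z)" "psnd z = diag_sum z - (z - triangle (diag_sum z))"
    unfolding x_def by (metis pfst_pair, metis psnd_pair)
qed

lemma rcf_diag_sum: "rcf 1 (\<lambda>ys. diag_sum (ys ! 0))"
  unfolding diag_sum_def by (intro rcf_rec rcf_zero rcf_add rcf_diff rcf_triangle rcf_Suc rcf_const rcf_nth) auto

lemma rcf_pfst: "rcf n f \<Longrightarrow> rcf n (\<lambda>xs. pfst (f xs))"
  and rcf_psnd: "rcf n f \<Longrightarrow> rcf n (\<lambda>xs. psnd (f xs))"
  unfolding pfst_psnd_diag_sum by (auto intro!: rcf_diff rcf_triangle rcf_comp1[OF rcf_diag_sum])

section \<open>Computable functions of one argument and their closure rules\<close>

definition cf :: "(nat \<Rightarrow> nat) \<Rightarrow> bool" where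
  "cf f \<longleftrightarrow> rcf 1 (\<lambda>xs. f (xs ! 0))"

lemma rcf_cf: "cf F \<Longrightarrow> rcf n f \<Longrightarrow> rcf n (\<lambda>xs. F (f xs))"
  unfolding cf_def by (rule rcf_comp1)

lemma cf_comp: "cf F \<Longrightarrow> cf f \<Longrightarrow> cf (\<lambda>x. F (f x))"
  unfolding cf_def by (rule rcf_comp1)

named_theorems cf_intros

lemma cf_basic [cf_intros]:
  "cf (\<lambda>x. x)" "cf (\<lambda>x. c)"
  "cf f \<Longrightarrow> cf (\<lambda>x. Suc (f x))"
  "cf f \<Longrightarrow> cf g \<Longrightarrow> cf (\<lambda>x. f x + g x)"
  "cf f \<Longrightarrow> cf g \<Longrightarrow> cf (\<lambda>x. f x * g x)"
  "cf f \<Longrightarrow> cf g \<Longrightarrow> cf (\<lambda>x. f x - g x)"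
  "cf f \<Longrightarrow> cf (\<lambda>x. pfst (f x))"
  "cf f \<Longrightarrow> cf (\<lambda>x. psnd (f x))"
  "cf f \<Longrightarrow> cf g \<Longrightarrow> cf (\<lambda>x. pair (f x) (g x))"
  unfolding cf_def
  by (auto intro: rcf_const rcf_nth rcf_Suc rcf_add rcf_mult rcf_diff rcf_pfst rcf_psnd rcf_pair)

lemma cf_rec:
  assumes "cf b" "cf a" "cf (\<lambda>z. g (pfst z) (pfst (psnd z)) (psnd (psnd z)))"
  shows "cf (\<lambda>x. rec_nat (a x) (\<lambda>k r. g k r x) (b x))"
  unfolding cf_def
proof (rule rcf_rec[where a = "\<lambda>xs. a (xs ! 0)" and b = "\<lambda>xs. b (xs ! 0)" and g = "\<lambda>k r xs. g k r (xs ! 0)"])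
  have "rcf 3 (\<lambda>ys. pair (ys ! 0) (pair (ys ! 1) (ys ! 2)))"
    by (intro rcf_pair rcf_nth) auto
  from rcf_cf[OF assms(3) this] show "rcf (Suc (Suc 1)) (\<lambda>ys. g (ys ! 0) (ys ! 1) (drop 2 ys ! 0))"
    by (simp add: numeral_3_eq_3 rcf_def)
qed (use assms in \<open>auto simp: cf_def\<close>)

text \<open>The bound variable becomes the second component of a pair whose first component is the
  old argument. Nested binders therefore turn into nested pairs, and the rules can descend through a
  formula of any depth.\<close>

lemma cf_sum [cf_intros]:
  assumes "cf b" "cf (\<lambda>z. g (pfst z) (psnd z))"
  shows "cf (\<lambda>x. \<Sum>i<b x. g x i)"
proof -
  have eq: "(\<Sum>i<n. h i) = rec_nat 0 (\<lambda>k r. r + h k) n" for n and h :: "nat \<Rightarrow> nat"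
    by (induction n) auto
  have "cf (\<lambda>z. pair (psnd (psnd z)) (pfst z))"
    by (intro cf_intros)
  from cf_comp[OF assms(2) this] have "cf (\<lambda>z. g (psnd (psnd z)) (pfst z))"
    by simp
  then show ?thesis
    unfolding eq by (intro cf_rec assms(1) cf_basic)
qed

lemma cf_power [cf_intros]: "cf f \<Longrightarrow> cf g \<Longrightarrow> cf (\<lambda>x. f x ^ g x)"
proof -
  assume f: "cf f" and g: "cf g"
  have eq: "a ^ n = rec_nat 1 (\<lambda>k r. a * r) n" for n and a :: nat
    by (induction n) auto
  \<comment> \<open>Inside the recursion the base is evaluated at a projection of the packed
    argument, which is why its computability is also supplied in composed form.\<close>
  show ?thesis
    unfolding eq by (intro cf_rec f g cf_intros cf_comp[OF f])
qed

lemma cf_funpow: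
  assumes "cf F" "cf n" "cf f"
  shows "cf (\<lambda>x. (F ^^ n x) (f x))"
proof -
  have eq: "(F ^^ n) a = rec_nat a (\<lambda>k r. F r) n" for n a
    by (induction n) auto
  show ?thesis
    unfolding eq by (intro cf_rec assms cf_intros cf_comp[OF assms(1)])
qed

section \<open>Decidable predicates, bounded quantifiers and integer arithmetic\<close>

definition cp :: "(nat \<Rightarrow> bool) \<Rightarrow> bool" where
  "cp P \<longleftrightarrow> cf (\<lambda>x. of_bool (P x))"

lemma cf_of_bool [cf_intros]: "cp P \<Longrightarrow> cf (\<lambda>x. of_bool (P x))"
  by (simp add: cp_def)

lemma cp_le [cf_intros]: "cf f \<Longrightarrow> cf g \<Longrightarrow> cp (\<lambda>x. f x \<le> g x)"
proof -
  have eq: "of_bool (a \<le> b) = 1 - (a - b)" for a b :: nat by auto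
  show "cf f \<Longrightarrow> cf g \<Longrightarrow> cp (\<lambda>x. f x \<le> g x)"
    unfolding cp_def eq by (intro cf_intros)
qed

lemma cp_conj [cf_intros]: "cp P \<Longrightarrow> cp Q \<Longrightarrow> cp (\<lambda>x. P x \<and> Q x)"
  unfolding cp_def of_bool_conj by (rule cf_intros)

lemma cp_not [cf_intros]: "cp P \<Longrightarrow> cp (\<lambda>x. \<not> P x)"
proof -
  have eq: "of_bool (\<not> b) = 1 - (of_bool b :: nat)" for b by auto
  show "cp P \<Longrightarrow> cp (\<lambda>x. \<not> P x)"
    unfolding cp_def eq by (intro cf_intros) (simp add: cp_def)
qed

lemma cp_disj [cf_intros]: "cp P \<Longrightarrow> cp Q \<Longrightarrow> cp (\<lambda>x. P x \<or> Q x)"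
  and cp_imp [cf_intros]: "cp P \<Longrightarrow> cp Q \<Longrightarrow> cp (\<lambda>x. P x \<longrightarrow> Q x)"
proof -
  assume "cp P" "cp Q"
  then have "cp (\<lambda>x. \<not> (\<not> P x \<and> \<not> Q x))" "cp (\<lambda>x. \<not> (P x \<and> \<not> Q x))"
    by (intro cf_intros; simp)+
  then show "cp (\<lambda>x. P x \<or> Q x)" "cp (\<lambda>x. P x \<longrightarrow> Q x)" by simp_all
qed

lemma cp_less [cf_intros]: "cf f \<Longrightarrow> cf g \<Longrightarrow> cp (\<lambda>x. f x < g x)"
  unfolding not_le[symmetric] by (intro cf_intros)

lemma cp_eq [cf_intros]: "cf f \<Longrightarrow> cf g \<Longrightarrow> cp (\<lambda>x. f x = g x)"
  unfolding eq_iff by (intro cf_intros)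

lemma cp_ex [cf_intros]:
  assumes "cf b" "cp (\<lambda>z. P (pfst z) (psnd z))"
  shows "cp (\<lambda>x. \<exists>i<b x. P x i)"
proof -
  have eq: "(\<exists>i<n. Q i) \<longleftrightarrow> 0 < (\<Sum>i<n. of_bool (Q i) :: nat)" for n :: nat and Q
    by (auto simp flip: neq0_conv)
  show ?thesis
    unfolding eq by (intro cf_intros assms)
qed

lemma cp_all [cf_intros]:
  assumes "cf b" "cp (\<lambda>z. P (pfst z) (psnd z))"
  shows "cp (\<lambda>x. \<forall>i<b x. P x i)"
proof -
  have "cp (\<lambda>x. \<not> (\<exists>i<b x. \<not> P x i))"
    by (intro cf_intros assms)
  then show ?thesis by simp
qed

lemma cf_if [cf_intros]: "cp P \<Longrightarrow> cf f \<Longrightarrow> cf g \<Longrightarrow> cf (\<lambda>x. if P x then f x else g x)"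
proof -
  have eq: "(if b then u else v) = of_bool b * u + of_bool (\<not> b) * v" for b and u v :: nat by auto
  show "cp P \<Longrightarrow> cf f \<Longrightarrow> cf g \<Longrightarrow> cf (\<lambda>x. if P x then f x else g x)"
    unfolding eq by (intro cf_intros)
qed

lemma cf_div [cf_intros]: "cf f \<Longrightarrow> cf g \<Longrightarrow> cf (\<lambda>x. f x div g x)"
proof -
  assume f: "cf f" and g: "cf g"
  \<comment> \<open>The quotient counts the positive multiples of n up to m. For positive n there
    are at most m of them, so m bounds the sum; the case n = 0 follows the convention for division
    by zero.\<close>
  have eq: "m div n = (if n = 0 then 0 else \<Sum>i<m. of_bool (Suc i * n \<le> m))" for m n :: nat
  proof (cases "n = 0")
    case False
    then have "(\<Sum>i<m. of_bool (Suc i * n \<le> m)) = card {i. i < m \<and> Suc i * n \<le> m}"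
      by (simp add: sum.If_cases of_bool_def Int_def)
    also have "{i. i < m \<and> Suc i * n \<le> m} = {..<m div n}"
    proof -
      have "Suc i * n \<le> m \<longleftrightarrow> i < m div n" for i
        using less_eq_div_iff_mult_less_eq[of n "Suc i" m] False by (simp add: Suc_le_eq)
      then show ?thesis
        using div_le_dividend[of m n] by (auto intro: less_le_trans)
    qed
    finally show ?thesis using False by simp
  qed simp
  show ?thesis
    unfolding eq by (intro cf_intros f g cf_comp[OF f] cf_comp[OF g])
qed

lemma cf_mod [cf_intros]: "cf f \<Longrightarrow> cf g \<Longrightarrow> cf (\<lambda>x. f x mod g x)"
  unfolding modulo_nat_def by (intro cf_intros)

text \<open>Integer-valued functions are handled through their positive and negative parts.\<close>

definition cfi :: "(nat \<Rightarrow> int) \<Rightarrow> bool" where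
  "cfi f \<longleftrightarrow> cf (\<lambda>x. nat (f x)) \<and> cf (\<lambda>x. nat (- f x))"

lemma cfi_const [cf_intros]: "cfi (\<lambda>x. c)"
  unfolding cfi_def by (intro conjI cf_intros)

lemma cfi_of_nat [cf_intros]: "cf f \<Longrightarrow> cfi (\<lambda>x. int (f x))"
  unfolding cfi_def by (simp add: cf_intros)

lemma cfi_uminus [cf_intros]: "cfi f \<Longrightarrow> cfi (\<lambda>x. - f x)"
  unfolding cfi_def by simp

lemma cfi_add [cf_intros]: "cfi f \<Longrightarrow> cfi g \<Longrightarrow> cfi (\<lambda>x. f x + g x)"
proof -
  have eq: "nat (a + b) = (nat a + nat b) - (nat (- a) + nat (- b))"
    "nat (- (a + b)) = (nat (- a) + nat (- b)) - (nat a + nat b)" for a b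
    by auto
  show "cfi f \<Longrightarrow> cfi g \<Longrightarrow> cfi (\<lambda>x. f x + g x)"
    unfolding cfi_def eq by (intro conjI cf_intros; simp)
qed

lemma cfi_diff [cf_intros]: "cfi f \<Longrightarrow> cfi g \<Longrightarrow> cfi (\<lambda>x. f x - g x)"
  using cfi_add[OF _ cfi_uminus] by simp

lemma cfi_mult [cf_intros]: "cfi f \<Longrightarrow> cfi g \<Longrightarrow> cfi (\<lambda>x. f x * g x)"
proof -
  have pos: "nat (a * b) = nat a * nat b + nat (- a) * nat (- b)" for a b
    by (cases "a \<ge> 0"; cases "b \<ge> 0")
      (auto simp: nat_mult_distrib nat_mult_distrib_neg mult_nonneg_nonpos mult_nonneg_nonpos2)
  have neg: "nat (- (a * b)) = nat a * nat (- b) + nat (- a) * nat b" for a b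
    using pos[of a "- b"] by simp
  show "cfi f \<Longrightarrow> cfi g \<Longrightarrow> cfi (\<lambda>x. f x * g x)"
    unfolding cfi_def pos neg by (intro conjI cf_intros; simp)
qed

lemma cfi_sum [cf_intros]:
  assumes "cf b" "cfi (\<lambda>z. g (pfst z) (psnd z))"
  shows "cfi (\<lambda>x. \<Sum>i<b x. g x i)"
proof -
  have eq: "(\<Sum>i<n. h i) = int (\<Sum>i<n. nat (h i)) - int (\<Sum>i<n. nat (- h i))"
    for h :: "nat \<Rightarrow> int" and n
    unfolding of_nat_sum sum_subtractf[symmetric] by (intro sum.cong) auto
  show ?thesis
    unfolding eq using assms by (intro cf_intros) (auto simp: cfi_def)
qed

lemma cp_int_le [cf_intros]: "cfi f \<Longrightarrow> cfi g \<Longrightarrow> cp (\<lambda>x. f x \<le> g x)"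
proof -
  have eq: "a \<le> b \<longleftrightarrow> nat (a - b) = 0" for a b :: int by auto
  assume "cfi f" "cfi g"
  then have "cfi (\<lambda>x. f x - g x)" by (rule cfi_diff)
  then show "cp (\<lambda>x. f x \<le> g x)"
    unfolding cfi_def eq by (intro cf_intros) auto
qed

lemma cp_int_less [cf_intros]: "cfi f \<Longrightarrow> cfi g \<Longrightarrow> cp (\<lambda>x. f x < g x)"
  unfolding not_le[symmetric] by (intro cf_intros)

lemma cp_int_eq [cf_intros]: "cfi f \<Longrightarrow> cfi g \<Longrightarrow> cp (\<lambda>x. f x = g x)"
  unfolding eq_iff by (intro cf_intros)

lemma cfi_if [cf_intros]: "cp P \<Longrightarrow> cfi f \<Longrightarrow> cfi g \<Longrightarrow> cfi (\<lambda>x. if P x then f x else g x)"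
  unfolding cfi_def if_distrib[of uminus] if_distrib[of nat] by (intro conjI cf_intros; simp)

lemma cp_even [cf_intros]: "cf f \<Longrightarrow> cp (\<lambda>x. even (f x))"
  unfolding even_iff_mod_2_eq_zero by (intro cf_intros)

lemma cfi_int_decode [cf_intros]: "cf f \<Longrightarrow> cfi (\<lambda>x. int_decode (f x))"
proof -
  have eq: "int_decode n = (if even n then int (n div 2) else - int (n div 2) - int 1)" for n
    by (simp add: int_decode_def sum_decode_def)
  show "cf f \<Longrightarrow> cfi (\<lambda>x. int_decode (f x))"
    unfolding eq by (intro cf_intros)
qed

section \<open>Decoding lists and digit expansions\<close>

definition lcdr :: "nat \<Rightarrow> nat" where "lcdr c = (if c = 0 then 0 else psnd (c - 1))"
definition lnth :: "nat \<Rightarrow> nat \<Rightarrow> nat" where "lnth c i = pfst ((lcdr ^^ i) c - 1)"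
text \<open>The empty list has code 0 and every other list a positive code, so this counts the
  nonempty tails. Summing up to the code itself suffices, since no list is longer than its
  code.\<close>

definition llen :: "nat \<Rightarrow> nat" where "llen c = (\<Sum>i<c. of_bool (0 < (lcdr ^^ i) c))"

lemma cf_lcdr_funpow [cf_intros]: "cf f \<Longrightarrow> cf n \<Longrightarrow> cf (\<lambda>x. (lcdr ^^ n x) (f x))"
proof (rule cf_funpow)
  show "cf lcdr" unfolding lcdr_def[abs_def] by (intro cf_intros)
qed

lemma cf_lnth [cf_intros]: "cf f \<Longrightarrow> cf g \<Longrightarrow> cf (\<lambda>x. lnth (f x) (g x))"
  unfolding lnth_def by (intro cf_intros)

lemma cf_llen [cf_intros]:
  assumes "cf f"
  shows "cf (\<lambda>x. llen (f x))"
proof (rule cf_comp[where F = llen, OF _ assms])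
  show "cf llen" unfolding llen_def[abs_def] by (intro cf_intros)
qed

lemma lcdr_funpow: "(lcdr ^^ i) (list_encode xs) = list_encode (drop i xs)"
proof -
  have "lcdr (list_encode ys) = list_encode (drop 1 ys)" for ys
    by (cases ys) (auto simp: lcdr_def)
  then show ?thesis by (induction i) (auto simp: drop_tl)
qed

lemma lnth_encode: "i < length xs \<Longrightarrow> lnth (list_encode xs) i = xs ! i"
  by (simp add: lnth_def lcdr_funpow flip: Cons_nth_drop_Suc)

lemma length_le_list_encode: "length xs \<le> list_encode xs"
proof (induction xs)
  case (Cons x xs)
  then show ?case using le_prod_encode_2[of "list_encode xs" x] by simp
qed simp

lemma llen_encode: "llen (list_encode xs) = length xs"
proof -
  have pos: "0 < list_encode ys \<longleftrightarrow> ys \<noteq> []" for ys by (cases ys) auto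
  have "llen (list_encode xs) = card {i. i < list_encode xs \<and> i < length xs}"
    by (simp add: llen_def lcdr_funpow pos sum.If_cases of_bool_def Int_def not_le)
  also have "{i. i < list_encode xs \<and> i < length xs} = {..<length xs}"
    using length_le_list_encode[of xs] by auto
  finally show ?thesis by simp
qed

text \<open>A function from \<open>{..<n}\<close> to \<open>{..<b}\<close> is coded by a number
  below \<open>b ^ n\<close>. Quantifying over such functions is thereby a bounded quantifier over
  numbers.\<close>

definition digit :: "nat \<Rightarrow> nat \<Rightarrow> nat \<Rightarrow> nat" where
  "digit b m i = m div b ^ i mod b"

lemma cf_digit [cf_intros]:
  "cf b \<Longrightarrow> cf m \<Longrightarrow> cf i \<Longrightarrow> cf (\<lambda>x. digit (b x) (m x) (i x))"
  unfolding digit_def by (intro cf_intros)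

lemma digit_less: "b > 0 \<Longrightarrow> digit b m i < b"
  by (simp add: digit_def)

lemma digits_exist:
  assumes "\<And>i. i < n \<Longrightarrow> f i < b"
  shows "\<exists>m<b ^ n. \<forall>i<n. digit b m i = f i"
  using assms
proof (induction n arbitrary: f)
  case (Suc n)
  have "\<exists>m<b ^ n. \<forall>i<n. digit b m i = f (Suc i)"
    by (rule Suc.IH) (simp add: Suc.prems)
  then obtain m where m: "m < b ^ n" "\<And>i. i < n \<Longrightarrow> digit b m i = f (Suc i)"
    by blast
  have f0: "f 0 < b" using Suc.prems by simp
  have "f 0 + b * m < b * Suc m" using f0 by simp
  also have "\<dots> \<le> b * b ^ n" using m(1) by (intro mult_le_mono2) simp
  finally have "f 0 + b * m < b ^ Suc n" by simp
  moreover have "digit b (f 0 + b * m) i = f i" if "i < Suc n" for i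
    using that f0 m(2)[of "i - 1"]
    by (cases i) (auto simp: digit_def div_mult2_eq)
  ultimately show ?case by blast
qed auto

section \<open>Integer solutions of homogeneous systems\<close>

text \<open>Multiply \<open>v\<close> by a common q that brings all its coordinates close to
  integers. A row that is nonpositive at \<open>v\<close> then has a value below 1 at the rounded
  vector; being an integer, that value is nonpositive.\<close>

lemma integer_solution_le:
  fixes v :: "'j \<Rightarrow> real" and R :: "('j \<Rightarrow> int) set"
  assumes "finite J" "finite R" "\<And>c. c \<in> R \<Longrightarrow> (\<Sum>j\<in>J. of_int (c j) * v j) \<le> 0" "\<epsilon> > 0"
  shows "\<exists>(q :: int) > 0. \<exists>p :: 'j \<Rightarrow> int.
    (\<forall>j\<in>J. \<bar>of_int q * v j - of_int (p j)\<bar> < \<epsilon>) \<and> (\<forall>c\<in>R. (\<Sum>j\<in>J. c j * p j) \<le> 0)"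
proof -
  \<comment> \<open>\<open>C\<close> is at least the sum of absolute values of the coefficients of
    any single row, so an error of at most 1/N in each coordinate changes a row by less than 1 once
    N exceeds C. The other summand of \<open>N\<close> brings the error below the prescribed
    \<epsilon>.\<close>
  define C where "C = (\<Sum>c\<in>R. \<Sum>j\<in>J. \<bar>c j\<bar>)"
  define N where "N = nat C + nat \<lceil>1 / \<epsilon>\<rceil> + 1"
  have N: "N > 0" by (simp add: N_def)
  have C0: "C \<ge> 0" by (simp add: C_def sum_nonneg)
  have "1 / \<epsilon> \<le> real (nat \<lceil>1 / \<epsilon>\<rceil>)" by (rule real_nat_ceiling_ge)
  also have "\<dots> < real N" unfolding N_def of_nat_add by simp
  finally have "1 / \<epsilon> < real N" .
  then have eps: "1 / real N < \<epsilon>" using assms(4) N by (simp add: field_simps)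
  obtain h where h: "bij_betw h {0..<card J} J"
    using ex_bij_betw_nat_finite[OF assms(1)] by blast
  obtain q p where q: "0 < q"
    and p: "\<And>i. i < card J \<Longrightarrow> \<bar>of_int q * v (h i) - of_int (p i)\<bar> < 1 / real N"
    using Dirichlet_approx_simult[OF N, of "card J" "\<lambda>i. v (h i)"] by metis
  define p' where "p' j = p (inv_into {0..<card J} h j)" for j
  have close: "\<bar>of_int q * v j - of_int (p' j)\<bar> < 1 / real N" if "j \<in> J" for j
  proof -
    have "inv_into {0..<card J} h j \<in> {0..<card J}" "h (inv_into {0..<card J} h j) = j"
      using h that inv_into_into[of j h "{0..<card J}"] by (auto simp: bij_betw_def f_inv_into_f)
    then show ?thesis using p[of "inv_into {0..<card J} h j"] by (simp add: p'_def)
  qed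
  have "(\<Sum>j\<in>J. c j * p' j) \<le> 0" if c: "c \<in> R" for c
  proof -
    have "real_of_int (\<Sum>j\<in>J. c j * p' j)
        = of_int q * (\<Sum>j\<in>J. of_int (c j) * v j) + (\<Sum>j\<in>J. of_int (c j) * (of_int (p' j) - of_int q * v j))"
      by (simp add: sum_distrib_left algebra_simps flip: sum.distrib)
    also have "\<dots> \<le> 0 + (\<Sum>j\<in>J. \<bar>of_int (c j)\<bar> * (1 / real N))"
    proof (intro add_mono sum_mono)
      show "of_int q * (\<Sum>j\<in>J. of_int (c j) * v j) \<le> 0"
        using q assms(3)[OF c] by (simp add: mult_nonneg_nonpos)
      fix j assume j: "j \<in> J"
      have "of_int (c j) * (of_int (p' j) - of_int q * v j) \<le> \<bar>of_int (c j) * (of_int (p' j) - of_int q * v j)\<bar>"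
        by simp
      also have "\<dots> \<le> \<bar>of_int (c j)\<bar> * (1 / real N)"
        unfolding abs_mult using close[OF j] by (intro mult_left_mono) auto
      finally show "of_int (c j) * (of_int (p' j) - of_int q * v j) \<le> \<bar>of_int (c j)\<bar> * (1 / real N)" .
    qed
    also have "\<dots> = of_int (\<Sum>j\<in>J. \<bar>c j\<bar>) / real N"
      by (simp add: sum_divide_distrib)
    also have "\<dots> < 1"
    proof -
      have "(\<Sum>j\<in>J. \<bar>c j\<bar>) \<le> C"
        unfolding C_def by (rule member_le_sum[OF c]) (auto simp: assms sum_nonneg)
      also have "C \<le> int (nat C)" by simp
      also have "int (nat C) < int N" unfolding of_nat_less_iff N_def by simp
      finally have "real_of_int (\<Sum>j\<in>J. \<bar>c j\<bar>) < real_of_int (int N)"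
        by (simp only: of_int_less_iff)
      then show ?thesis using N by simp
    qed
    finally show ?thesis by linarith
  qed
  moreover have "\<bar>of_int q * v j - of_int (p' j)\<bar> < \<epsilon>" if "j \<in> J" for j
    using close[OF that] eps by linarith
  ultimately show ?thesis using q by blast
qed

text \<open>Each equation is split into two inequalities. The threshold \<open>1 / card J\<close>
  serves to keep the solution nonzero: nonnegative weights with total 1 always contain an entry of
  at least that size.\<close>

lemma nat_solution_eq:
  fixes v :: "'j \<Rightarrow> real" and R :: "('j \<Rightarrow> int) set"
  assumes "finite J" "finite R" "\<And>c. c \<in> R \<Longrightarrow> (\<Sum>j\<in>J. of_int (c j) * v j) = 0"
    and "\<And>j. j \<in> J \<Longrightarrow> v j \<ge> 0"
  shows "\<exists>p :: 'j \<Rightarrow> nat. (\<forall>j\<in>J. v j \<ge> 1 / real (card J) \<longrightarrow> p j > 0) \<and>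
    (\<forall>c\<in>R. (\<Sum>j\<in>J. c j * int (p j)) = 0)"
proof -
  \<comment> \<open>At most 1, so that rounding a nonnegative coordinate cannot give -1; and below
    \<open>1 / card J\<close>, so that a coordinate above the threshold cannot be rounded to
    0.\<close>
  define \<epsilon> where "\<epsilon> = 1 / real (Suc (card J))"
  have \<epsilon>: "\<epsilon> > 0" "\<epsilon> \<le> 1" by (auto simp: \<epsilon>_def)
  define R2 where "R2 = R \<union> (\<lambda>c j. - c j) ` R"
  have R2: "(\<Sum>j\<in>J. of_int (c j) * v j) \<le> 0" if "c \<in> R2" for c
    using that assms(3) by (auto simp: R2_def sum_negf)
  have fR2: "finite R2" using assms(2) by (simp add: R2_def)
  obtain q :: int and p :: "'j \<Rightarrow> int" where q: "q > 0"
    and close: "\<forall>j\<in>J. \<bar>of_int q * v j - of_int (p j)\<bar> < \<epsilon>"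
    and le: "\<forall>c\<in>R2. (\<Sum>j\<in>J. c j * p j) \<le> 0"
    using integer_solution_le[OF assms(1) fR2 R2 \<epsilon>(1)] by blast
  have nonneg: "p j \<ge> 0" if "j \<in> J" for j
  proof -
    have "of_int q * v j \<ge> 0" using q assms(4)[OF that] by simp
    then have "real_of_int (p j) > - 1" using close[rule_format, OF that] \<epsilon>(2) by linarith
    then show ?thesis by linarith
  qed
  have eq: "(\<Sum>j\<in>J. c j * int (nat (p j))) = 0" if c: "c \<in> R" for c
  proof -
    have "(\<Sum>j\<in>J. - c j * p j) \<le> 0"
      by (rule le[rule_format, of "\<lambda>j. - c j"]) (simp add: R2_def c)
    moreover have "(\<Sum>j\<in>J. c j * p j) \<le> 0"
      by (rule le[rule_format]) (simp add: R2_def c)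
    ultimately have "(\<Sum>j\<in>J. c j * p j) = 0" by (simp add: sum_negf)
    then show ?thesis using nonneg by simp
  qed
  have "nat (p j) > 0" if j: "j \<in> J" "v j \<ge> 1 / real (card J)" for j
  proof -
    have "card J > 0" using j(1) assms(1) by (auto simp: card_gt_0_iff)
    then have "\<epsilon> < 1 / real (card J)" by (simp add: \<epsilon>_def frac_less2)
    also have "\<dots> \<le> v j" by (rule j(2))
    also have "\<dots> \<le> of_int q * v j" using q assms(4)[OF j(1)] mult_right_mono[of 1 "of_int q" "v j"] by simp
    finally show ?thesis using close[rule_format, OF j(1)] by linarith
  qed
  then show ?thesis using eq by (intro exI[of _ "\<lambda>j. nat (p j)"]) auto
qed

section \<open>Convex and conic combinations, and Farkas' lemma\<close>

text \<open>The weights belong to indices rather than to points, so \<open>f\<close> need not be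
  injective; this accommodates lists in which a point occurs repeatedly.\<close>

lemma convex_hull_image_weights:
  fixes f :: "'j \<Rightarrow> 'a::real_vector"
  assumes "finite A" "z \<in> convex hull (f ` A)"
  obtains w where "\<And>l. l \<in> A \<Longrightarrow> w l \<ge> 0" "sum w A = 1" "z = (\<Sum>l\<in>A. w l *\<^sub>R f l)"
proof -
  let ?C = "{\<Sum>l\<in>A. w l *\<^sub>R f l | w. (\<forall>l\<in>A. w l \<ge> 0) \<and> sum w A = (1::real)}"
  have "convex hull (f ` A) \<subseteq> ?C"
  proof (rule hull_minimal)
    show "f ` A \<subseteq> ?C"
    proof clarify
      fix l assume l: "l \<in> A"
      show "\<exists>w. f l = (\<Sum>l\<in>A. w l *\<^sub>R f l) \<and> (\<forall>l\<in>A. w l \<ge> 0) \<and> sum w A = 1"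
        using l assms(1) by (intro exI[of _ "\<lambda>m. if m = l then 1 else 0"])
          (auto simp: if_distrib[of "\<lambda>x. x *\<^sub>R _"] cong: if_cong)
    qed
    show "convex ?C"
    proof (rule convexI; clarify)
      fix u v :: real and w w' :: "'j \<Rightarrow> real"
      assume "0 \<le> u" "0 \<le> v" "u + v = 1" "\<forall>l\<in>A. 0 \<le> w l" "sum w A = 1" "\<forall>l\<in>A. 0 \<le> w' l" "sum w' A = 1"
      then show "\<exists>wa. u *\<^sub>R (\<Sum>l\<in>A. w l *\<^sub>R f l) + v *\<^sub>R (\<Sum>l\<in>A. w' l *\<^sub>R f l) = (\<Sum>l\<in>A. wa l *\<^sub>R f l)
          \<and> (\<forall>l\<in>A. 0 \<le> wa l) \<and> sum wa A = 1"
        by (intro exI[of _ "\<lambda>l. u * w l + v * w' l"])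
          (auto simp: scaleR_sum_right scaleR_left_distrib sum.distrib simp flip: sum_distrib_left)
    qed
  qed
  then show thesis using assms(2) that by blast
qed

lemma convex_cone_hull_image_weights:
  fixes f :: "'j \<Rightarrow> 'a::real_vector"
  assumes "finite A" "z \<in> convex_cone hull (f ` A)"
  obtains w where "\<And>l. l \<in> A \<Longrightarrow> w l \<ge> 0" "z = (\<Sum>l\<in>A. w l *\<^sub>R f l)"
proof -
  let ?C = "{\<Sum>l\<in>A. w l *\<^sub>R f l | w. \<forall>l\<in>A. w l \<ge> (0::real)}"
  have "convex_cone hull (f ` A) \<subseteq> ?C"
  proof (rule hull_minimal)
    show "f ` A \<subseteq> ?C"
    proof clarify
      fix l assume l: "l \<in> A"
      show "\<exists>w. f l = (\<Sum>l\<in>A. w l *\<^sub>R f l) \<and> (\<forall>l\<in>A. w l \<ge> 0)"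
        using l assms(1) by (intro exI[of _ "\<lambda>m. if m = l then 1 else 0"])
          (auto simp: if_distrib[of "\<lambda>x. x *\<^sub>R _"] cong: if_cong)
    qed
    show "convex_cone ?C"
      unfolding convex_cone_iff
    proof (intro conjI ballI allI impI; clarify?)
      show "\<exists>w. 0 = (\<Sum>l\<in>A. w l *\<^sub>R f l) \<and> (\<forall>l\<in>A. w l \<ge> 0)"
        by (intro exI[of _ "\<lambda>_. 0"]) auto
      fix w w' :: "'j \<Rightarrow> real" assume w: "\<forall>l\<in>A. 0 \<le> w l" 
      show "\<exists>wa. (\<Sum>l\<in>A. w l *\<^sub>R f l) + (\<Sum>l\<in>A. w' l *\<^sub>R f l) = (\<Sum>l\<in>A. wa l *\<^sub>R f l)
          \<and> (\<forall>l\<in>A. 0 \<le> wa l)" if "\<forall>l\<in>A. 0 \<le> w' l"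
        using w that by (intro exI[of _ "\<lambda>l. w l + w' l"]) (auto simp: scaleR_left_distrib sum.distrib)
      show "\<exists>wa. c *\<^sub>R (\<Sum>l\<in>A. w l *\<^sub>R f l) = (\<Sum>l\<in>A. wa l *\<^sub>R f l) \<and> (\<forall>l\<in>A. 0 \<le> wa l)"
        if "0 \<le> c" for c
        using w that by (intro exI[of _ "\<lambda>l. c * w l"]) (auto simp: scaleR_sum_right)
    qed
  qed
  then show thesis using assms(2) that by blast
qed

text \<open>A finitely generated cone is closed, so a point outside it is strictly separated from
  it; as a cone is closed under scaling, the separating functional must have constant sign on the
  generators.\<close>

lemma Farkas_alternative:
  fixes A :: "'a::euclidean_space set"
  assumes "finite A" "e \<notin> convex_cone hull A"
  obtains u where "\<And>a. a \<in> A \<Longrightarrow> a \<bullet> u \<le> 0" "e \<bullet> u > 0"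
proof -
  obtain c b where c: "c \<bullet> e < b" "\<And>x. x \<in> convex_cone hull A \<Longrightarrow> c \<bullet> x > b"
    using separating_hyperplane_closed_point[OF convex_convex_cone_hull closed_convex_cone_hull] assms
    by metis
  have b: "b < 0" using c(2)[OF convex_cone_hull_contains_0] by simp
  have "c \<bullet> a \<ge> 0" if a: "a \<in> A" for a
  proof (rule ccontr)
    assume neg: "\<not> c \<bullet> a \<ge> 0"
    \<comment> \<open>A multiple of the generator lying exactly on the separating hyperplane; the
      factor is nonnegative because numerator and denominator are both negative.\<close>
    have "(b / (c \<bullet> a)) *\<^sub>R a \<in> convex_cone hull A"
      using a b neg by (intro convex_cone_hull_mul hull_inc) (auto simp: divide_nonpos_neg)
    from c(2)[OF this] neg show False by simp
  qed
  then show thesis using c(1) b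
    by (intro that[of "- c"]) (auto simp: inner_commute)
qed

section \<open>Integral forms of Farkas' lemma and of intersecting hulls\<close>

definition lvec :: "('n \<Rightarrow> nat) \<Rightarrow> (nat \<Rightarrow> int) \<Rightarrow> real^'n" where
  "lvec ord g = (\<chi> i. real_of_int (g (ord i)))"

context
  fixes ord :: "'n::finite \<Rightarrow> nat"
  assumes ord: "bij_betw ord UNIV {..<CARD('n)}"
begin

lemma inv_ord: "i < CARD('n) \<Longrightarrow> ord (inv ord i) = i"
  using ord by (metis bij_betw_inv_into_right lessThan_iff)

lemma sum_ord: "(\<Sum>i\<in>UNIV. f (ord i)) = (\<Sum>i<CARD('n). f i)"
  using sum.reindex_bij_betw[OF ord] .

lemma ord_less: "ord i < CARD('n)"
  using ord by (auto simp: bij_betw_def)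

lemma inner_lvec: "lvec ord g \<bullet> lvec ord h = of_int (\<Sum>i<CARD('n). g i * h i)"
  by (simp add: inner_vec_def lvec_def sum_ord[of "\<lambda>i. of_int (g i) * of_int (h i)", simplified])

lemma inner_lvec_left: "lvec ord g \<bullet> x = (\<Sum>i<CARD('n). of_int (g i) * x $ inv ord i)"
proof -
  have inv: "inv ord (ord i) = i" for i
    using ord by (simp add: bij_betw_def)
  show ?thesis
    unfolding sum_ord[symmetric] by (simp add: inner_vec_def lvec_def inv)
qed

lemma lvec_eq_iff: "lvec ord g = lvec ord h \<longleftrightarrow> (\<forall>i<CARD('n). g i = h i)"
proof -
  have "(\<forall>i<CARD('n). g i = h i) \<longleftrightarrow> (\<forall>i. g (ord i) = h (ord i))"
    using ord_less inv_ord by metis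
  then show ?thesis by (simp add: lvec_def vec_eq_iff)
qed

lemma int_lattice_eq: "(int_lattice :: (real^'n) set) = range (lvec ord)"
proof (intro equalityI subsetI)
  fix x :: "real^'n" assume "x \<in> int_lattice"
  then have "x = lvec ord (\<lambda>j. \<lfloor>x $ inv ord j\<rfloor>)"
    using ord by (auto simp: int_lattice_def lvec_def vec_eq_iff bij_betw_def)
  then show "x \<in> range (lvec ord)" by blast
qed (auto simp: int_lattice_def lvec_def)

text \<open>Only integral test vectors occur in the hypothesis. If e were outside the real cone of
  the rows, the separating real vector could be rounded to an integral one that still satisfies all
  rows and is still positive on e. Hence e is a real conic combination, and treating the coefficient
  of e as one more unknown makes the relation homogeneous, so its multipliers can be made natural
  numbers.\<close>

lemma Farkas_integer:
  fixes a :: "nat \<Rightarrow> nat \<Rightarrow> int" and e :: "nat \<Rightarrow> int"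
  assumes no: "\<And>p. (\<And>j. j < k \<Longrightarrow> (\<Sum>i<CARD('n). a j i * p i) \<le> 0) \<Longrightarrow> (\<Sum>i<CARD('n). e i * p i) \<le> 0"
  shows "\<exists>(r :: nat \<Rightarrow> nat) m. m > 0 \<and> (\<forall>i<CARD('n). (\<Sum>j<k. int (r j) * a j i) = int m * e i)"
proof -
  let ?d = "CARD('n)"
  have "lvec ord e \<in> convex_cone hull ((\<lambda>j. lvec ord (a j)) ` {..<k})"
  proof (rule ccontr)
    assume "\<not> ?thesis"
    then obtain u where u: "\<And>j. j < k \<Longrightarrow> lvec ord (a j) \<bullet> u \<le> 0" "lvec ord e \<bullet> u > 0"
      by (rule Farkas_alternative[rotated]) auto
    \<comment> \<open>The rounding changes the value at e by at most
      \<open>(E - 1) * \<epsilon>\<close>, which is less than \<open>E * \<epsilon>\<close>, the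
      value at the unrounded vector. The summand 1 gives the strict inequality and keeps
      \<open>E\<close> positive.\<close>
    define E where "E = 1 + (\<Sum>i<?d. \<bar>real_of_int (e i)\<bar>)"
    have E: "E > 0" by (simp add: E_def sum_nonneg add_pos_nonneg)
    define \<epsilon> where "\<epsilon> = (lvec ord e \<bullet> u) / E"
    have \<epsilon>: "\<epsilon> > 0" using u(2) E by (simp add: \<epsilon>_def)
    define R where "R = a ` {..<k}"
    have fR: "finite R" by (simp add: R_def)
    have R: "(\<Sum>i<?d. of_int (c i) * u $ inv ord i) \<le> 0" if "c \<in> R" for c
      using that u(1) by (auto simp: R_def inner_lvec_left)
    obtain q :: int and p :: "nat \<Rightarrow> int" where q: "q > 0"
      and close: "\<forall>i\<in>{..<?d}. \<bar>of_int q * u $ inv ord i - of_int (p i)\<bar> < \<epsilon>"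
      and le: "\<forall>c\<in>R. (\<Sum>i<?d. c i * p i) \<le> 0"
      using integer_solution_le[OF finite_lessThan fR R \<epsilon>] by blast
    have "(\<Sum>i<?d. e i * p i) \<le> 0" by (rule no) (use le in \<open>simp add: R_def\<close>)
    moreover have "real_of_int (\<Sum>i<?d. e i * p i) > 0"
    proof -
      have "of_int q * (lvec ord e \<bullet> u) - real_of_int (\<Sum>i<?d. e i * p i)
          = (\<Sum>i<?d. of_int (e i) * (of_int q * u $ inv ord i - of_int (p i)))"
        by (simp add: inner_lvec_left sum_distrib_left algebra_simps sum_subtractf)
      also have "\<dots> \<le> (\<Sum>i<?d. \<bar>of_int (e i)\<bar> * \<epsilon>)"
      proof (rule sum_mono)
        fix i assume i: "i \<in> {..<?d}"
        have "of_int (e i) * (of_int q * u $ inv ord i - of_int (p i))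
            \<le> \<bar>of_int (e i) * (of_int q * u $ inv ord i - of_int (p i))\<bar>" by simp
        also have "\<dots> \<le> \<bar>of_int (e i)\<bar> * \<epsilon>"
          unfolding abs_mult using close[rule_format, OF i] by (intro mult_left_mono) auto
        finally show "of_int (e i) * (of_int q * u $ inv ord i - of_int (p i)) \<le> \<bar>of_int (e i)\<bar> * \<epsilon>" .
      qed
      also have "\<dots> = (E - 1) * \<epsilon>" by (simp add: E_def sum_distrib_right)
      also have "\<dots> < E * \<epsilon>" using \<epsilon> by simp
      also have "\<dots> = lvec ord e \<bullet> u" using E by (simp add: \<epsilon>_def)
      also have "\<dots> \<le> of_int q * (lvec ord e \<bullet> u)"
        using q u(2) by simp
      finally show ?thesis by simp
    qed
    ultimately show False by simp
  qed
  then obtain w where w: "\<And>j. j \<in> {..<k} \<Longrightarrow> w j \<ge> 0"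
    and e: "lvec ord e = (\<Sum>j<k. w j *\<^sub>R lvec ord (a j))"
    using convex_cone_hull_image_weights[of "{..<k}"] by blast
  \<comment> \<open>Index k carries the coefficient of e. Its value 1 exceeds no less than the
    threshold \<open>1 / (k + 1)\<close> requires, so the resulting denominator \<open>p k\<close>
    is positive.\<close>
  define v where "v = (\<lambda>j. if j < k then w j else 1)"
  define R where "R = (\<lambda>i j. if j < k then a j i else - e i) ` {..<?d}"
  have R: "(\<Sum>j\<in>{..k}. of_int (c j) * v j) = 0" if "c \<in> R" for c
  proof -
    obtain i where i: "i < ?d" "c = (\<lambda>j. if j < k then a j i else - e i)" using \<open>c \<in> R\<close> by (auto simp: R_def)
    have "lvec ord e $ inv ord i = (\<Sum>j<k. w j *\<^sub>R lvec ord (a j)) $ inv ord i" by (simp only: e)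
    then have "(\<Sum>j<k. of_int (a j i) * w j) = of_int (e i)"
      by (simp add: lvec_def inv_ord i(1) mult.commute)
    then show ?thesis by (simp add: i(2) v_def lessThan_Suc_atMost[symmetric])
  qed
  have fR: "finite R" by (simp add: R_def)
  have v0: "v j \<ge> 0" if "j \<in> {..k}" for j
    using that w by (simp add: v_def)
  obtain p :: "nat \<Rightarrow> nat" where pos: "\<forall>j\<in>{..k}. v j \<ge> 1 / real (card {..k}) \<longrightarrow> p j > 0"
    and eq: "\<forall>c\<in>R. (\<Sum>j\<in>{..k}. c j * int (p j)) = 0"
    using nat_solution_eq[OF finite_atMost fR R v0] by blast
  have "(\<Sum>j<k. int (p j) * a j i) = int (p k) * e i" if "i < ?d" for i
    using bspec[OF eq, of "\<lambda>j. if j < k then a j i else - e i"] that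
    by (simp add: R_def lessThan_Suc_atMost[symmetric] mult.commute)
  moreover have "p k > 0" using bspec[OF pos, of k] by (simp add: v_def)
  ultimately show ?thesis by (intro exI[of _ p] exI[of _ "p k"]) simp
qed

text \<open>The two families of weights together solve a homogeneous integer system: equal totals,
  and equal combinations in each coordinate. Dividing by the common total would turn a natural
  solution back into rational convex combinations.\<close>

lemma hulls_meet_integer:
  fixes x :: "'j \<Rightarrow> nat \<Rightarrow> int" and y :: "'k \<Rightarrow> nat \<Rightarrow> int"
  assumes fin: "finite A" "finite B"
    and meet: "convex hull ((\<lambda>l. lvec ord (x l)) ` A) \<inter> convex hull ((\<lambda>l. lvec ord (y l)) ` B) \<noteq> {}"
  obtains r :: "'j \<Rightarrow> nat" and s :: "'k \<Rightarrow> nat"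
  where "sum r A > 0" "sum r A = sum s B"
    "\<And>i. i < CARD('n) \<Longrightarrow> (\<Sum>l\<in>A. int (r l) * x l i) = (\<Sum>l\<in>B. int (s l) * y l i)"
proof -
  obtain z where z: "z \<in> convex hull ((\<lambda>l. lvec ord (x l)) ` A)" "z \<in> convex hull ((\<lambda>l. lvec ord (y l)) ` B)"
    using meet by blast
  obtain w where w: "\<And>l. l \<in> A \<Longrightarrow> w l \<ge> 0" "sum w A = 1" "z = (\<Sum>l\<in>A. w l *\<^sub>R lvec ord (x l))"
    using convex_hull_image_weights[OF fin(1) z(1)] by blast
  obtain w' where w': "\<And>l. l \<in> B \<Longrightarrow> w' l \<ge> 0" "sum w' B = 1" "z = (\<Sum>l\<in>B. w' l *\<^sub>R lvec ord (y l))"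
    using convex_hull_image_weights[OF fin(2) z(2)] by blast
  \<comment> \<open>A disjoint union, so that the weights of both sides form a single vector of
    unknowns.\<close>
  define J where "J = A <+> B"
  define R where "R = insert (case_sum (\<lambda>_. 1) (\<lambda>_. - 1))
    ((\<lambda>i. case_sum (\<lambda>l. x l i) (\<lambda>l. - y l i)) ` {..<CARD('n)})"
  define v where "v = case_sum w w'"
  have fJ: "finite J" "finite R" using fin by (auto simp: J_def R_def)
  have v0: "v j \<ge> 0" if "j \<in> J" for j
    using that w(1) w'(1) by (auto simp: v_def J_def)
  have R: "(\<Sum>j\<in>J. of_int (c j) * v j) = 0" if "c \<in> R" for c
  proof -
    have "(\<Sum>l\<in>A. of_int (x l i) * w l) = (\<Sum>l\<in>B. of_int (y l i) * w' l)" if "i < CARD('n)" for i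
    proof -
      have "(\<Sum>l\<in>A. w l *\<^sub>R lvec ord (x l)) $ inv ord i = (\<Sum>l\<in>B. w' l *\<^sub>R lvec ord (y l)) $ inv ord i"
        by (simp only: w(3)[symmetric] w'(3)[symmetric])
      then show ?thesis by (simp add: lvec_def inv_ord that mult.commute)
    qed
    then show ?thesis
      using \<open>c \<in> R\<close> w(2) w'(2) fin by (auto simp: R_def J_def v_def sum.Plus sum_negf)
  qed
  obtain p :: "'j + 'k \<Rightarrow> nat" where pos: "\<forall>j\<in>J. v j \<ge> 1 / real (card J) \<longrightarrow> p j > 0"
    and eq: "\<forall>c\<in>R. (\<Sum>j\<in>J. c j * int (p j)) = 0"
    using nat_solution_eq[OF fJ R v0] by blast
  show thesis
  proof (rule that[of "\<lambda>l. p (Inl l)" "\<lambda>l. p (Inr l)"])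
    have A: "A \<noteq> {}" using w(2) by auto
    \<comment> \<open>Otherwise the weights on \<open>A\<close> would sum to less than
      \<open>card A / card J\<close>, which is at most 1. The entry found here survives the rounding
      and makes the total positive.\<close>
    have "\<exists>l\<in>A. w l \<ge> 1 / real (card J)"
    proof (rule ccontr)
      assume "\<not> ?thesis"
      then have "sum w A < (\<Sum>l\<in>A. 1 / real (card J))"
        using A fin by (intro sum_strict_mono) auto
      also have "\<dots> = real (card A) / real (card J)" by simp
      also have "\<dots> \<le> 1" using fin A by (simp add: J_def card_Plus card_gt_0_iff divide_le_eq)
      finally show False using w(2) by simp
    qed
    then obtain l where l: "l \<in> A" "w l \<ge> 1 / real (card J)" by blast
    have "p (Inl l) > 0" by (rule pos[rule_format]) (use l in \<open>auto simp: v_def J_def\<close>)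
    then show "(\<Sum>l\<in>A. p (Inl l)) > 0" by (intro sum_pos2[OF fin(1) l(1)]) auto
    have "int (\<Sum>l\<in>A. p (Inl l)) = int (\<Sum>l\<in>B. p (Inr l))"
      using bspec[OF eq, of "case_sum (\<lambda>_. 1) (\<lambda>_. - 1)"] fin by (simp add: R_def J_def sum.Plus sum_negf)
    then show "(\<Sum>l\<in>A. p (Inl l)) = (\<Sum>l\<in>B. p (Inr l))" by (simp only: of_nat_eq_iff)
    show "(\<Sum>l\<in>A. int (p (Inl l)) * x l i) = (\<Sum>l\<in>B. int (p (Inr l)) * y l i)" if "i < CARD('n)" for i
      using bspec[OF eq, of "case_sum (\<lambda>l. x l i) (\<lambda>l. - y l i)"] that fin
      by (simp add: R_def J_def sum.Plus sum_negf mult.commute)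
  qed
qed

end

section \<open>Facets and systems of inequalities\<close>

definition pol :: "('a::euclidean_space \<times> real) set \<Rightarrow> 'a set" where
  "pol S = {x. \<forall>(a, b)\<in>S. a \<bullet> x \<le> b}"

lemma pol_mono: "S' \<subseteq> S \<Longrightarrow> pol S \<subseteq> pol S'"
  by (auto simp: pol_def)

lemma pol_eq_Inter: "pol S = \<Inter>((\<lambda>(a, b). {x. a \<bullet> x \<le> b}) ` S)"
  by (auto simp: pol_def)

lemma polyhedron_eq_pol:
  "polyhedron P \<longleftrightarrow> (\<exists>S. finite S \<and> P = pol S)"
proof
  assume "polyhedron P"
  then obtain F where F: "finite F" "P = \<Inter>F" "\<forall>h\<in>F. \<exists>a b. a \<noteq> 0 \<and> h = {x. a \<bullet> x \<le> b}"
    unfolding polyhedron_def by blast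
  then obtain a b where ab: "\<And>h. h \<in> F \<Longrightarrow> {x. a h \<bullet> x \<le> b h} = h" by metis
  have "P = pol ((\<lambda>h. (a h, b h)) ` F)"
    unfolding F(2) pol_eq_Inter by (simp add: image_image ab)
  then show "\<exists>S. finite S \<and> P = pol S" using F(1) by blast
next
  assume "\<exists>S. finite S \<and> P = pol S"
  then obtain S where S: "finite S" "P = pol S" by blast
  show "polyhedron P"
    unfolding S(2) pol_eq_Inter using S(1)
    by (intro polyhedron_Inter) (auto simp: polyhedron_halfspace_le)
qed

lemma minimal_system_facets:
  fixes S :: "('a::euclidean_space \<times> real) set"
  assumes "finite S" and int: "interior (pol S) \<noteq> {}"
  shows "\<exists>S'\<subseteq>S. pol S' = pol S \<and> card S' = card {F. F facet_of pol S}"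
proof -
  define P where "P = pol S"
  obtain S' where S': "S' \<subseteq> S" "pol S' = P" 
    and min: "\<And>T. T \<subseteq> S \<Longrightarrow> pol T = P \<Longrightarrow> card S' \<le> card T"
    using ex_has_least_nat[of "\<lambda>T. T \<subseteq> S \<and> pol T = P" S card] by (auto simp: P_def)
  have fin: "finite S'" using S'(1) assms(1) by (rule finite_subset)
  have irr: "pol T \<noteq> P" if "T \<subset> S'" for T
    using min[of T] psubset_card_mono[OF fin that] S'(1) that by auto
  obtain z where z: "z \<in> interior P" using int by (auto simp: P_def)
  have zP: "z \<in> P" using z interior_subset by blast
  have nz: "fst p \<noteq> 0" if p: "p \<in> S'" for p
  proof
    assume "fst p = 0"
    moreover have "fst p \<bullet> z \<le> snd p" using zP p by (auto simp: S'(2)[symmetric] pol_def case_prod_beta)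
    ultimately have "pol (S' - {p}) = pol S'" by (auto simp: pol_def)
    then show False using irr[of "S' - {p}"] p S'(2) by auto
  qed
  have strict: "fst p \<bullet> z < snd p" if p: "p \<in> S'" for p
  proof -
    have "P \<subseteq> {x. fst p \<bullet> x \<le> snd p}" using p by (auto simp: S'(2)[symmetric] pol_def)
    from interior_mono[OF this] z show ?thesis using nz[OF p] by (auto simp: interior_halfspace_le)
  qed
  define H where "H = (\<lambda>p :: 'a \<times> real. {x. fst p \<bullet> x \<le> snd p})"
  have PH: "pol T = \<Inter>(H ` T)" for T
    by (force simp: pol_def H_def)
  \<comment> \<open>\<open>facet_of_polyhedron_explicit\<close> works with a set of halfspaces. Two
    rows describing the same halfspace would make one of them redundant, so a row can be recovered
    from its halfspace.\<close>
  have injH: "inj_on H S'"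
  proof (rule inj_onI, rule ccontr)
    fix p p' assume p: "p \<in> S'" "p' \<in> S'" "H p = H p'" "p \<noteq> p'"
    then have "H ` (S' - {p'}) = H ` S'" by auto
    then have "pol (S' - {p'}) = P" unfolding PH S'(2)[symmetric] by simp
    then show False using irr[of "S' - {p'}"] p(2) by auto
  qed
  define g where "g = inv_into S' H"
  have g: "g (H p) = p" if "p \<in> S'" for p
    using injH that by (simp add: g_def)
  have aff: "affine hull P = UNIV"
    using z by (intro affine_hull_nonempty_interior) auto
  have facet: "C facet_of P \<longleftrightarrow> (\<exists>h. h \<in> H ` S' \<and> C = P \<inter> {x. fst (g h) \<bullet> x = snd (g h)})" for C
  proof (rule facet_of_polyhedron_explicit)
    show "finite (H ` S')" using fin by simp
    show "P = affine hull P \<inter> \<Inter> (H ` S')" unfolding aff using S'(2) PH by simp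
    show "fst (g h) \<noteq> 0 \<and> h = {x. fst (g h) \<bullet> x \<le> snd (g h)}" if "h \<in> H ` S'" for h
      using that nz g by (auto simp: H_def[symmetric]) (auto simp: H_def)
    show "P \<subset> affine hull P \<inter> \<Inter> F'" if F': "F' \<subset> H ` S'" for F'
    proof -
      obtain T where T: "T \<subseteq> S'" "F' = H ` T" using F' by (metis psubset_imp_subset subset_image_iff)
      then have "T \<subset> S'" using F' by auto
      from irr[OF this] pol_mono[OF T(1)] show ?thesis
        unfolding aff T(2) PH[symmetric] S'(2) by auto
    qed
  qed
  define G where "G = (\<lambda>p :: 'a \<times> real. P \<inter> {x. fst p \<bullet> x = snd p})"
  have facets: "{F. F facet_of P} = G ` S'"
    using g by (auto simp: facet G_def)
  \<comment> \<open>A facet has the dimension of the hyperplane that contains it, so it spans that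
    hyperplane.\<close>
  have hull: "affine hull (G p) = {x. fst p \<bullet> x = snd p}" if p: "p \<in> S'" for p
  proof (rule ccontr)
    assume ne: "\<not> ?thesis"
    have "affine hull (G p) \<subseteq> {x. fst p \<bullet> x = snd p}"
      by (intro hull_minimal affine_hyperplane) (auto simp: G_def)
    then have "affine hull (G p) \<subset> {x. fst p \<bullet> x = snd p}" using ne by auto
    then have "aff_dim (G p) < aff_dim {x. fst p \<bullet> x = snd p}"
      by (intro aff_dim_psubset) (simp add: hull_hull affine_hyperplane[THEN affine_hull_eq[THEN iffD2]])
    moreover have "G p facet_of P" using facets p by blast
    then have "aff_dim (G p) = aff_dim P - 1" by (simp add: facet_of_def)
    moreover have "aff_dim P = DIM('a)" using aff aff_dim_eq_full by blast
    ultimately show False using nz[OF p] by simp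
  qed
  text \<open>
    If two inequalities had the same facet, their hyperplanes would coincide, and a segment from an
    interior point to a point cut off only by the second would violate the first as well.
  \<close>
  have "inj_on G S'"
  proof (rule inj_onI, rule ccontr)
    fix p p' assume p: "p \<in> S'" "p' \<in> S'" "G p = G p'" "p \<noteq> p'"
    have hyp: "fst p \<bullet> x = snd p \<longleftrightarrow> fst p' \<bullet> x = snd p'" for x
      using hull[OF p(1)] hull[OF p(2)] p(3) by auto
    have "pol (S' - {p'}) \<noteq> P" using irr p(2) by auto
    then obtain y where y: "y \<in> pol (S' - {p'})" "y \<notin> P" using pol_mono[of "S' - {p'}" S'] S'(2) by auto
    obtain q where q: "q \<in> S'" "fst q \<bullet> y > snd q"
      using y(2) by (auto simp: S'(2)[symmetric] pol_def case_prod_beta not_le)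
    have "q = p'"
    proof (rule ccontr)
      assume "q \<noteq> p'"
      then have "fst q \<bullet> y \<le> snd q" using y(1) q(1) by (auto simp: pol_def case_prod_beta)
      then show False using q(2) by simp
    qed
    then have y': "fst p' \<bullet> y > snd p'" using q(2) by simp
    have yp: "fst p \<bullet> y \<le> snd p" using y(1) p(1,4) by (auto simp: pol_def case_prod_beta)
    define u where "u = (snd p' - fst p' \<bullet> z) / (fst p' \<bullet> y - fst p' \<bullet> z)"
    have u: "0 < u" "u < 1" using strict[OF p(2)] y' by (auto simp: u_def)
    have "fst p' \<bullet> (z + u *\<^sub>R (y - z)) = snd p'"
      using strict[OF p(2)] y' by (simp add: u_def inner_simps)
    then have "fst p \<bullet> (z + u *\<^sub>R (y - z)) = snd p" using hyp by blast
    then have eq: "(1 - u) * (fst p \<bullet> z) + u * (fst p \<bullet> y) = snd p" by (simp add: inner_simps algebra_simps)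
    have "(1 - u) * (fst p \<bullet> z) < (1 - u) * snd p" using u strict[OF p(1)] by simp
    moreover have "u * (fst p \<bullet> y) \<le> u * snd p" using u yp by simp
    ultimately have "(1 - u) * (fst p \<bullet> z) + u * (fst p \<bullet> y) < snd p" by (simp add: algebra_simps)
    then show False using eq by simp
  qed
  then have "card {F. F facet_of P} = card S'" unfolding facets by (rule card_image)
  then show ?thesis using S' unfolding P_def by auto
qed

lemma num_facets_le:
  assumes "finite S" "interior (pol S) \<noteq> {}"
  shows "num_facets (pol S) \<le> card S"
  using minimal_system_facets[OF assms] card_mono[OF assms(1)] by (metis num_facets_def)

lemma interior_convex_hull_full_dim:
  fixes X :: "(real^'n) set"
  assumes "aff_dim X = int CARD('n)"
  shows "interior (convex hull X) \<noteq> {}"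
proof -
  have "affine hull (convex hull X) = UNIV"
    using assms aff_dim_eq_full[of X] by (simp add: affine_hull_convex_hull)
  then have "rel_interior (convex hull X) = interior (convex hull X)" by (rule rel_interior_interior)
  moreover have "X \<noteq> {}" using assms by auto
  ultimately show ?thesis by (metis convex_convex_hull convex_hull_eq_empty rel_interior_eq_empty)
qed

lemma convex_pol: "finite S \<Longrightarrow> convex (pol S)"
  by (metis polyhedron_eq_pol polyhedron_imp_convex)

lemma interior_pol:
  fixes X :: "(real^'n) set"
  assumes "finite S" "aff_dim X = int CARD('n)" "X \<subseteq> pol S"
  shows "interior (pol S) \<noteq> {}"
  using interior_convex_hull_full_dim[OF assms(2)]
    interior_mono[OF hull_minimal[of X "pol S" convex, OF assms(3) convex_pol[OF assms(1)]]] by auto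

section \<open>Comparing and attaining the complexity numbers\<close>

lemma rc_rel_le_card:
  fixes S :: "((real^'n) \<times> real) set" and X Y :: "(real^'n) set"
  assumes "finite S" "\<forall>x\<in>X. \<forall>(a, b)\<in>S. a \<bullet> x \<le> b" "\<forall>y\<in>Y - X. \<exists>(a, b)\<in>S. a \<bullet> y > b"
  shows "rc_rel X Y \<le> card S"
  unfolding rc_rel_def using assms by (intro Least_le) blast

context
  fixes X :: "(real^'n) set"
  assumes full: "aff_dim X = int CARD('n)"
begin

lemma rc_le_card:
  assumes "finite S" "pol S \<inter> int_lattice = X"
  shows "rc X \<le> card S"
proof -
  have "rc X \<le> num_facets (pol S)"
    unfolding rc_def using assms polyhedron_eq_pol by (intro Least_le) blast
  also have "\<dots> \<le> card S" using assms full by (intro num_facets_le interior_pol) auto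
  finally show ?thesis .
qed

text \<open>The convex hull of \<open>X\<close> shows that the minimum ranges over a nonempty set.
  An optimal polyhedron inherits an interior from \<open>X\<close>, so its facets can be exchanged
  for equally many inequalities.\<close>

lemma rc_attained:
  assumes "finite X" "lattice_convex X"
  shows "\<exists>S. finite S \<and> pol S \<inter> int_lattice = X \<and> card S = rc X"
proof -
  have "\<exists>k P. polyhedron P \<and> P \<inter> int_lattice = X \<and> num_facets P = k"
    using assms by (intro exI[of _ "num_facets (convex hull X)"] exI[of _ "convex hull X"])
      (simp add: lattice_convex_def polyhedron_convex_hull)
  from LeastI_ex[OF this] obtain P where P: "polyhedron P" "P \<inter> int_lattice = X" "num_facets P = rc X"
    unfolding rc_def[symmetric] by blast
  obtain S where S: "finite S" "P = pol S" using P(1) polyhedron_eq_pol by blast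
  have "interior (pol S) \<noteq> {}" using S P full by (intro interior_pol) auto
  then obtain S' where "S' \<subseteq> S" "pol S' = pol S" "card S' = num_facets P"
    using minimal_system_facets[OF S(1)] S(2) unfolding num_facets_def by blast
  then show ?thesis using S P finite_subset[of S' S] by (intro exI[of _ S']) simp
qed

text \<open>Rationality survives the passage from facets to inequalities because the smallest system
  is selected from the given rational one.\<close>

lemma rc_Q_attained:
  assumes "\<exists>P. rational_polyhedron P \<and> P \<inter> int_lattice = X"
  shows "\<exists>S. finite S \<and> pol S \<inter> int_lattice = X \<and> card S = rc_Q X
    \<and> (\<forall>(a, b)\<in>S. (\<forall>i. a $ i \<in> \<rat>) \<and> b \<in> \<rat>)"
proof -
  have "\<exists>k P. rational_polyhedron P \<and> P \<inter> int_lattice = X \<and> num_facets P = k"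
    using assms by blast
  from LeastI_ex[OF this] obtain P where P: "rational_polyhedron P" "P \<inter> int_lattice = X" "num_facets P = rc_Q X"
    unfolding rc_Q_def[symmetric] by blast
  obtain S where S: "finite S" "P = pol S" and rat: "\<forall>(a, b)\<in>S. (\<forall>i. a $ i \<in> \<rat>) \<and> b \<in> \<rat>"
    using P(1) unfolding rational_polyhedron_def pol_def[symmetric] by blast
  have "interior (pol S) \<noteq> {}" using S P full by (intro interior_pol) auto
  then obtain S' where S': "S' \<subseteq> S" "pol S' = pol S" "card S' = num_facets P"
    using minimal_system_facets[OF S(1)] S(2) unfolding num_facets_def by blast
  have "\<forall>(a, b)\<in>S'. (\<forall>i. a $ i \<in> \<rat>) \<and> b \<in> \<rat>" using S'(1) rat by blast
  then show ?thesis using S S' P finite_subset[OF S'(1)] by (intro exI[of _ S']) simp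
qed

lemma separating_system:
  fixes T :: "((real^'n) \<times> real) set"
  assumes "pol T \<inter> int_lattice = X" "Y \<subseteq> int_lattice"
  shows "(\<forall>x\<in>X. \<forall>(a, b)\<in>T. a \<bullet> x \<le> b) \<and> (\<forall>y\<in>Y - X. \<exists>(a, b)\<in>T. a \<bullet> y > b)"
  using assms by (fastforce simp: pol_def not_le)

lemma rc_rel_le_rc:
  assumes "finite X" "lattice_convex X" "Y \<subseteq> int_lattice"
  shows "rc_rel X Y \<le> rc X"
proof -
  obtain S where S: "finite S" "pol S \<inter> int_lattice = X" "card S = rc X"
    using rc_attained[OF assms(1,2)] by blast
  show ?thesis
    unfolding rc_rel_def using separating_system[OF S(2) assms(3)] S by (intro Least_le exI[of _ S]) auto
qed

lemma rc_rel_attained: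
  assumes "finite X" "lattice_convex X" "Y \<subseteq> int_lattice"
  shows "\<exists>S. finite S \<and> card S = rc_rel X Y \<and> (\<forall>x\<in>X. \<forall>(a, b)\<in>S. a \<bullet> x \<le> b)
    \<and> (\<forall>y\<in>Y - X. \<exists>(a, b)\<in>S. a \<bullet> y > b)"
proof -
  obtain S where S: "finite S" "pol S \<inter> int_lattice = X" "card S = rc X"
    using rc_attained[OF assms(1,2)] by blast
  have "\<exists>k S. finite S \<and> card S = k \<and> (\<forall>x\<in>X. \<forall>(a, b)\<in>S. a \<bullet> x \<le> b)
    \<and> (\<forall>y\<in>Y - X. \<exists>(a, b)\<in>S. a \<bullet> y > b)"
    using separating_system[OF S(2) assms(3)] S by blast
  then show ?thesis unfolding rc_rel_def by (rule LeastI_ex)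
qed

text \<open>On natural numbers \<open>Sup\<close> is a true maximum for finite nonempty sets; here
  all members are bounded by \<open>rc X\<close>.\<close>

lemma rc_l_attained:
  assumes "finite X" "lattice_convex X"
  shows "\<exists>t>0. rc_rel X (box t) = rc_l X"
proof -
  let ?R = "{rc_rel X (box t) | t. t > 0}"
  have "?R \<subseteq> {..rc X}"
    using rc_rel_le_rc[OF assms] by (auto simp: box_def)
  then have "finite ?R" using finite_subset by blast
  moreover have "?R \<noteq> {}" by blast
  ultimately have "Sup ?R \<in> ?R" by (metis (no_types, lifting) Max_in Sup_nat_def)
  then show ?thesis by (auto simp: rc_l_def)
qed

lemma rc_eq_rc_Q:
  assumes "finite X" "lattice_convex X" "rc_l X = rc_Q X"
    and rat: "\<exists>P. rational_polyhedron P \<and> P \<inter> int_lattice = X"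
  shows "rc X = rc_Q X"
proof -
  obtain t :: nat where "rc_rel X (box t) = rc_l X"
    using rc_l_attained[OF assms(1,2)] by blast
  then have "rc_Q X \<le> rc X"
    using rc_rel_le_rc[OF assms(1,2), of "box t"] assms(3) by (auto simp: box_def)
  moreover obtain S where "finite S" "pol S \<inter> int_lattice = X" "card S = rc_Q X"
    using rc_Q_attained[OF rat] by blast
  then have "rc X \<le> rc_Q X" using rc_le_card by metis
  ultimately show ?thesis by simp
qed

end

section \<open>Certificates and their search\<close>

definition pt :: "nat \<Rightarrow> nat \<Rightarrow> nat \<Rightarrow> int" where
  "pt E l i = int_decode (lnth (lnth E l) i)"

text \<open>Shifting the digits in base 2t + 1 by t gives all integers from -t to t. The same device
  thus enumerates the points of a box and the coefficient tables with entries bounded by W.\<close>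

definition sdigit :: "nat \<Rightarrow> nat \<Rightarrow> nat \<Rightarrow> int" where
  "sdigit t y i = int (digit (2 * t + 1) y i) - int t"

definition is_pt :: "nat \<Rightarrow> nat \<Rightarrow> (nat \<Rightarrow> int) \<Rightarrow> bool" where
  "is_pt d E g \<longleftrightarrow> (\<exists>l<llen E. \<forall>i<d. pt E l i = g i)"

text \<open>
  In \<open>rc_le_cert\<close> the number \<open>s\<close> codes k rows of d coefficients followed by a right-hand side; the
  last clause asks for multipliers combining the rows to a positive multiple of each signed unit
  vector, the sign being 1 - 2e.
\<close>

definition rc_le_cert :: "nat \<Rightarrow> nat \<Rightarrow> nat \<Rightarrow> nat \<Rightarrow> bool" where
  "rc_le_cert d E k W \<longleftrightarrow> (\<exists>s<(2 * W + 1) ^ (k * Suc d).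
     (\<forall>l<llen E. \<forall>j<k. (\<Sum>i<d. sdigit W s (j * Suc d + i) * pt E l i) \<le> sdigit W s (j * Suc d + d)) \<and>
     (\<forall>y<(2 * W + 1) ^ d. is_pt d E (sdigit W y) \<or>
        (\<exists>j<k. sdigit W s (j * Suc d + d) < (\<Sum>i<d. sdigit W s (j * Suc d + i) * sdigit W y i))) \<and>
     (\<forall>i<d. \<forall>e<2. \<exists>r<Suc W ^ k. \<exists>m<Suc W. 0 < m \<and>
        (\<forall>h<d. (\<Sum>j<k. int (digit (Suc W) r j) * sdigit W s (j * Suc d + h))
           = int m * (if h = i then 1 - 2 * int e else 0)) \<and>
        (\<Sum>j<k. int (digit (Suc W) r j) * sdigit W s (j * Suc d + d)) \<le> int m * int W))"

text \<open>
  In \<open>rc_ge_cert\<close> the digits of \<open>f\<close> assign a class to every point of the box, where the class k - 1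
  stands for "not cut off". Allowing this extra class makes the case k = 1 (some point of the box lies
  outside X) an instance of the general one.
\<close>

definition rc_ge_cert :: "nat \<Rightarrow> nat \<Rightarrow> nat \<Rightarrow> nat \<Rightarrow> nat \<Rightarrow> bool" where
  "rc_ge_cert d E k t W \<longleftrightarrow> (\<forall>f<k ^ ((2 * t + 1) ^ d).
     (\<exists>y<(2 * t + 1) ^ d. \<not> is_pt d E (sdigit t y) \<and> Suc (digit k f y) = k) \<or>
     (\<exists>c<k - 1. \<exists>r<Suc W ^ llen E. \<exists>s<Suc W ^ ((2 * t + 1) ^ d).
        (\<forall>y<(2 * t + 1) ^ d. 0 < digit (Suc W) s y \<longrightarrow> \<not> is_pt d E (sdigit t y) \<and> digit k f y = c) \<and>
        0 < (\<Sum>l<llen E. digit (Suc W) r l) \<and>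
        (\<Sum>l<llen E. digit (Suc W) r l) = (\<Sum>y<(2 * t + 1) ^ d. digit (Suc W) s y) \<and>
        (\<forall>i<d. (\<Sum>l<llen E. int (digit (Suc W) r l) * pt E l i)
           = (\<Sum>y<(2 * t + 1) ^ d. int (digit (Suc W) s y) * sdigit t y i))))"

text \<open>The number \<open>N\<close> packs the claimed value, the radius of the box for the lower
  bound, and the common bound on all entries. The value comes first, so the answer is a projection
  of whatever the search finds.\<close>

definition rc_cert :: "nat \<Rightarrow> nat \<Rightarrow> nat \<Rightarrow> bool" where
  "rc_cert d E N \<longleftrightarrow> rc_le_cert d E (pfst N) (psnd (psnd N)) \<and>
     rc_ge_cert d E (pfst N) (pfst (psnd N)) (psnd (psnd N))"

text \<open>Every quantifier in the certificates has an explicit computable bound, so decidability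
  follows from the shape of the formula alone.\<close>

lemma cp_rc_cert: "cp (\<lambda>x. rc_cert d (pfst x) (psnd x))"
  unfolding rc_cert_def rc_le_cert_def rc_ge_cert_def is_pt_def sdigit_def pt_def
  by (intro cf_intros)

text \<open>Minimisation requires its argument to be defined and positive before the first zero; the
  characteristic function of the negation of \<open>Q\<close> is total with values 0 and 1, so a
  single witness makes the search stop.\<close>

lemma mu_search:
  assumes Q: "cp (\<lambda>x. Q (pfst x) (psnd x))" and h: "cf h"
  shows "\<exists>p. \<forall>x. (\<exists>n. Q x n) \<longrightarrow> evalf p [x] (h (LEAST n. Q x n))"
proof -
  have "cf (\<lambda>x. of_bool (\<not> Q (pfst x) (psnd x)))"
    by (intro cf_intros Q)
  \<comment> \<open>\<open>Mnf\<close> puts the search variable in front of the parameter, whereas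
    \<open>Q\<close> takes the parameter first.\<close>
  moreover have "rcf 2 (\<lambda>xs. pair (xs ! 1) (xs ! 0))"
    by (intro rcf_pair rcf_nth) auto
  ultimately have "rcf 2 (\<lambda>xs. of_bool (\<not> Q (xs ! 1) (xs ! 0)))"
    using rcf_cf[of "\<lambda>x. of_bool (\<not> Q (pfst x) (psnd x))" 2 "\<lambda>xs. pair (xs ! 1) (xs ! 0)"] by simp
  then obtain q where q: "\<And>xs. length xs = 2 \<Longrightarrow> evalf q xs (of_bool (\<not> Q (xs ! 1) (xs ! 0)))"
    unfolding rcf_def by blast
  have q0: "evalf q [n, x] 0" if "Q x n" for n x
    using q[of "[n, x]"] that by simp
  have q1: "evalf q [n, x] (Suc 0)" if "\<not> Q x n" for n x
    using q[of "[n, x]"] that by simp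
  obtain ph where ph: "\<And>xs. length xs = 1 \<Longrightarrow> evalf ph xs (h (xs ! 0))"
    using h unfolding cf_def rcf_def by blast
  have "evalf (Cnf ph [Mnf q]) [x] (h (LEAST n. Q x n))" if ex: "\<exists>n. Q x n" for x
  proof (rule evalf.comp[where ys = "[LEAST n. Q x n]"])
    have "evalf (Mnf q) [x] (LEAST n. Q x n)"
      by (rule evalf.mu) (use q0 q1 LeastI_ex[OF ex] not_less_Least in blast)+
    then show "list_all2 (\<lambda>g y. evalf g [x] y) [Mnf q] [LEAST n. Q x n]" by simp
    show "evalf ph [LEAST n. Q x n] (h (LEAST n. Q x n))"
      using ph[of "[LEAST n. Q x n]"] by simp
  qed
  then show ?thesis by blast
qed

section \<open>Integral grids and rational half-spaces\<close>

lemma sdigit_exist: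
  assumes "\<And>i. i < n \<Longrightarrow> \<bar>v i\<bar> \<le> int W"
  shows "\<exists>s<(2 * W + 1) ^ n. \<forall>i<n. sdigit W s i = v i"
proof -
  have "nat (v i + int W) < 2 * W + 1" if "i < n" for i
    using assms[OF that] by linarith
  from digits_exist[of n "\<lambda>i. nat (v i + int W)", OF this]
  obtain s where s: "s < (2 * W + 1) ^ n" "\<And>i. i < n \<Longrightarrow> digit (2 * W + 1) s i = nat (v i + int W)"
    by blast
  have "sdigit W s i = v i" if "i < n" for i
    using s(2)[OF that] assms[OF that] unfolding sdigit_def by simp
  with s(1) show ?thesis by blast
qed

lemma abs_sdigit_le: "\<bar>sdigit t y i\<bar> \<le> int t"
  using digit_less[of "2 * t + 1" y i] by (simp add: sdigit_def)

lemma lvec_ord_in_int_lattice: "lvec ord g \<in> int_lattice"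
  by (simp add: int_lattice_def lvec_def)

lemma finite_rationals_common_denominator:
  fixes A :: "real set"
  assumes "finite A" "A \<subseteq> \<rat>"
  shows "\<exists>m::int. m > 0 \<and> (\<forall>r\<in>A. of_int m * r \<in> \<int>)"
  using assms
proof (induction A rule: finite_induct)
  case empty
  show ?case by (intro exI[of _ 1]) simp
next
  case (insert r A)
  then obtain m :: int where m: "m > 0" "\<forall>r\<in>A. of_int m * r \<in> \<int>" by auto
  obtain a b :: int where ab: "b > 0" "r = of_int a / of_int b"
    using insert.prems by (auto elim: Rats_cases')
  have "of_int (b * m) * r = of_int (m * a)" using ab by simp
  then have "of_int (b * m) * r \<in> \<int>" by (simp only: Ints_of_int)
  moreover have "of_int (b * m) * r' \<in> \<int>" if "r' \<in> A" for r'
    using m(2) that Ints_mult[of "of_int b" "of_int m * r'"] by (simp add: mult.assoc)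
  ultimately show ?case using m(1) ab(1) by (intro exI[of _ "b * m"]) auto
qed

text \<open>Strict separation of a point from a compact hull leaves a gap. Scaling the functional
  widens the gap, while taking floors of the coefficients costs an error that does not depend on the
  scale.\<close>

lemma separating_integer_functional:
  fixes X :: "(real^'n) set"
  assumes "finite X" "y \<notin> convex hull X"
  shows "\<exists>a b. (\<forall>i. a $ i \<in> \<int>) \<and> b \<in> \<int> \<and> (\<forall>x\<in>X. a \<bullet> x \<le> b) \<and> a \<bullet> y > b"
proof -
  have "closed (convex hull X)"
    using assms(1) by (simp add: compact_imp_closed finite_imp_compact_convex_hull)
  then obtain c \<beta> where c: "c \<bullet> y < \<beta>" "\<forall>x\<in>convex hull X. c \<bullet> x > \<beta>"
    using separating_hyperplane_closed_point[OF convex_convex_hull _ assms(2)] by blast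
  define u where "u = - c"
  have u: "u \<bullet> y > - \<beta>" "u \<bullet> x \<le> - \<beta>" if "x \<in> X" for x
    using c(1) bspec[OF c(2) hull_inc[OF that]] by (auto simp: u_def)
  have uy: "u \<bullet> y + \<beta> > 0" using c(1) by (simp add: u_def)
  define C where "C = (\<Sum>x\<in>insert y X. \<Sum>i\<in>UNIV. \<bar>x $ i\<bar>)"
  \<comment> \<open>The gap must pay for the floor error \<open>C\<close> on \<open>X\<close>, the
    same error at \<open>y\<close>, at most 1 for making \<open>b\<close> integral, and a further 1
    for strictness; hence the numerator 2C + 2.\<close>
  define q where "q = real (nat \<lceil>(2 * C + 2) / (u \<bullet> y + \<beta>)\<rceil>)"
  define a :: "real^'n" where "a = (\<chi> i. of_int \<lfloor>q * u $ i\<rfloor>)"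
  define b where "b = real_of_int (\<lfloor>C - q * \<beta>\<rfloor> + 1)"
  have "q \<ge> (2 * C + 2) / (u \<bullet> y + \<beta>)" unfolding q_def by (rule real_nat_ceiling_ge)
  then have q: "q * (u \<bullet> y + \<beta>) \<ge> 2 * C + 2" using uy by (simp add: field_simps)
  have q0: "q \<ge> 0" by (simp add: q_def)
  have close: "\<bar>a \<bullet> x - q * (u \<bullet> x)\<bar> \<le> C" if "x \<in> insert y X" for x
  proof -
    have "\<bar>a \<bullet> x - q * (u \<bullet> x)\<bar> = \<bar>\<Sum>i\<in>UNIV. (of_int \<lfloor>q * u $ i\<rfloor> - q * u $ i) * x $ i\<bar>"
      by (simp add: inner_vec_def a_def sum_distrib_left sum_subtractf algebra_simps)
    also have "\<dots> \<le> (\<Sum>i\<in>UNIV. \<bar>(of_int \<lfloor>q * u $ i\<rfloor> - q * u $ i) * x $ i\<bar>)" by (rule sum_abs)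
    also have "\<dots> \<le> (\<Sum>i\<in>UNIV. \<bar>x $ i\<bar>)"
    proof (rule sum_mono)
      fix i
      have "\<bar>of_int \<lfloor>q * u $ i\<rfloor> - q * u $ i\<bar> \<le> 1" by linarith
      then show "\<bar>(of_int \<lfloor>q * u $ i\<rfloor> - q * u $ i) * x $ i\<bar> \<le> \<bar>x $ i\<bar>"
        unfolding abs_mult by (simp add: mult_left_le_one_le)
    qed
    also have "\<dots> \<le> C"
      unfolding C_def by (rule member_le_sum[OF that]) (use assms(1) in \<open>auto simp: sum_nonneg\<close>)
    finally show ?thesis .
  qed
  have b: "C - q * \<beta> \<le> b" "b \<le> C - q * \<beta> + 1" unfolding b_def by linarith+
  have "a \<bullet> x \<le> b" if x: "x \<in> X" for x
  proof -
    have "a \<bullet> x \<le> q * (u \<bullet> x) + C" using close[of x] x unfolding abs_le_iff by simp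
    also have "q * (u \<bullet> x) \<le> q * (- \<beta>)" using u(2)[OF x] q0 by (rule mult_left_mono)
    finally show ?thesis using b(1) by simp
  qed
  moreover have "a \<bullet> y > b"
    using close[of y] q b(2) unfolding abs_le_iff by (simp add: algebra_simps)
  moreover have "\<forall>i. a $ i \<in> \<int>" "b \<in> \<int>" by (auto simp: a_def b_def)
  ultimately show ?thesis by blast
qed

context
  fixes ord :: "'n::finite \<Rightarrow> nat"
  assumes ord: "bij_betw ord UNIV {..<CARD('n)}"
begin

lemma box_eq_grid:
  "(box t :: (real^'n) set) = (\<lambda>y. lvec ord (sdigit t y)) ` {..<(2 * t + 1) ^ CARD('n)}"
proof (intro equalityI subsetI)
  fix x :: "real^'n" assume "x \<in> box t"
  then have bound: "\<And>i. \<bar>x $ i\<bar> \<le> real t" and "x \<in> int_lattice" by (auto simp: box_def)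
  then obtain g where g: "x = lvec ord g" using int_lattice_eq[OF ord] by blast
  have "\<bar>g i\<bar> \<le> int t" if "i < CARD('n)" for i
  proof -
    have "\<bar>real_of_int (g i)\<bar> \<le> real t"
      using bound[of "inv ord i"] inv_ord[OF ord that] by (simp add: g lvec_def)
    then show ?thesis by linarith
  qed
  then obtain y where "y < (2 * t + 1) ^ CARD('n)" "\<forall>i<CARD('n). sdigit t y i = g i"
    using sdigit_exist by blast
  then show "x \<in> (\<lambda>y. lvec ord (sdigit t y)) ` {..<(2 * t + 1) ^ CARD('n)}"
    by (intro image_eqI[of _ _ y]) (auto simp: g lvec_eq_iff[OF ord])
next
  fix x :: "real^'n" assume "x \<in> (\<lambda>y. lvec ord (sdigit t y)) ` {..<(2 * t + 1) ^ CARD('n)}"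
  then obtain y where x: "x = lvec ord (sdigit t y)" by blast
  have "\<bar>real_of_int (sdigit t y i)\<bar> \<le> real t" for i
    using abs_sdigit_le[of t y i] by linarith
  then show "x \<in> box t"
    unfolding box_def x using lvec_ord_in_int_lattice by (auto simp: lvec_def)
qed

lemma finite_box: "finite (box t :: (real^'n) set)"
  by (simp add: box_eq_grid)

text \<open>This ensures that the minimum defining \<open>rc_Q\<close> is attained. A box containing
  \<open>X\<close> leaves only finitely many lattice points to exclude, and by lattice-convexity
  each of them lies outside the hull and is removed by one integral cut.\<close>

lemma rational_polyhedron_exists:
  fixes X :: "(real^'n) set"
  assumes "finite X" "lattice_convex X"
  shows "\<exists>P. rational_polyhedron P \<and> P \<inter> int_lattice = X"
proof -
  have lat: "X \<subseteq> int_lattice" using assms(2) by (auto simp: lattice_convex_def)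
  define t where "t = nat \<lceil>\<Sum>x\<in>X. \<Sum>i\<in>UNIV. \<bar>x $ i\<bar>\<rceil>"
  have bound: "\<bar>x $ i\<bar> \<le> real t" if x: "x \<in> X" for x i
  proof -
    have "\<bar>x $ i\<bar> \<le> (\<Sum>i\<in>UNIV. \<bar>x $ i\<bar>)" by (rule member_le_sum) auto
    also have "\<dots> \<le> (\<Sum>x\<in>X. \<Sum>i\<in>UNIV. \<bar>x $ i\<bar>)"
      by (rule member_le_sum[OF x]) (auto simp: sum_nonneg assms(1))
    also have "\<dots> \<le> real t" unfolding t_def by (rule real_nat_ceiling_ge)
    finally show ?thesis .
  qed
  have "\<exists>a b. (\<forall>i. a $ i \<in> \<int>) \<and> b \<in> \<int> \<and> (\<forall>x\<in>X. a \<bullet> x \<le> b) \<and> a \<bullet> y > b"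
    if "y \<in> box t - X" for y
    using that assms by (intro separating_integer_functional) (auto simp: lattice_convex_def box_def)
  then obtain a b where ab: "\<And>y i. y \<in> box t - X \<Longrightarrow> a y $ i \<in> \<int>"
    "\<And>y. y \<in> box t - X \<Longrightarrow> b y \<in> \<int>" "\<And>y x. y \<in> box t - X \<Longrightarrow> x \<in> X \<Longrightarrow> a y \<bullet> x \<le> b y"
    "\<And>y. y \<in> box t - X \<Longrightarrow> a y \<bullet> y > b y" by metis
  define S where "S = (\<lambda>y. (a y, b y)) ` (box t - X) \<union> (\<lambda>i. (axis i 1, real t)) ` UNIV
    \<union> (\<lambda>i. (axis i (- 1), real t)) ` UNIV"
  have "rational_polyhedron (pol S)"
    unfolding rational_polyhedron_def
  proof (intro exI[of _ S] conjI)
    show "finite S" by (simp add: S_def finite_box)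
    show "\<forall>(a, b)\<in>S. (\<forall>i. a $ i \<in> \<rat>) \<and> b \<in> \<rat>"
      using ab(1,2) Ints_subset_Rats by (auto simp: S_def axis_def)
    show "pol S = {x. \<forall>(a, b)\<in>S. a \<bullet> x \<le> b}" by (rule pol_def)
  qed
  moreover have "X \<subseteq> pol S"
  proof
    fix x assume x: "x \<in> X"
    have "x $ i \<le> real t" "- x $ i \<le> real t" for i using bound[OF x, of i] by auto
    then show "x \<in> pol S"
      using ab(3) x by (auto simp: pol_def S_def inner_axis inner_commute[of "axis _ _"])
  qed
  moreover have "pol S \<inter> int_lattice \<subseteq> X"
  proof
    fix z assume z: "z \<in> pol S \<inter> int_lattice"
    have "\<bar>z $ i\<bar> \<le> real t" for i
    proof -
      have "(axis i 1, real t) \<in> S" "(axis i (- 1), real t) \<in> S" by (auto simp: S_def)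
      then have "axis i 1 \<bullet> z \<le> real t" "axis i (- 1) \<bullet> z \<le> real t"
        using z by (auto simp: pol_def)
      then show ?thesis by (simp add: inner_axis inner_commute[of "axis _ _"])
    qed
    then have "z \<in> box t" using z by (simp add: box_def)
    moreover have "z \<notin> box t - X"
    proof
      assume *: "z \<in> box t - X"
      then have "(a z, b z) \<in> S" by (auto simp: S_def)
      then show False using z ab(4)[OF *] by (auto simp: pol_def)
    qed
    ultimately show "z \<in> X" by simp
  qed
  ultimately show ?thesis using lat by (intro exI[of _ "pol S"]) auto
qed

lemma rational_halfspace_integer:
  fixes \<alpha> :: "real^'n"
  assumes "\<forall>i. \<alpha> $ i \<in> \<rat>" "\<beta> \<in> \<rat>"
  shows "\<exists>a b. \<forall>x. \<alpha> \<bullet> x \<le> \<beta> \<longleftrightarrow> lvec ord a \<bullet> x \<le> real_of_int b"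
proof -
  obtain m :: int where m: "m > 0" "\<forall>r\<in>insert \<beta> (range (($) \<alpha>)). of_int m * r \<in> \<int>"
    using finite_rationals_common_denominator[of "insert \<beta> (range (($) \<alpha>))"] assms by auto
  define a where "a i = \<lfloor>of_int m * \<alpha> $ inv ord i\<rfloor>" for i
  have "inv ord (ord i) = i" for i using ord by (simp add: bij_betw_def)
  then have a: "lvec ord a = of_int m *\<^sub>R \<alpha>" using m(2) by (simp add: lvec_def a_def vec_eq_iff)
  have "\<alpha> \<bullet> x \<le> \<beta> \<longleftrightarrow> lvec ord a \<bullet> x \<le> real_of_int \<lfloor>of_int m * \<beta>\<rfloor>" for x
    using m by (simp add: a)
  then show ?thesis by blast
qed

lemma rational_system_integer:
  fixes S :: "((real^'n) \<times> real) set"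
  assumes "finite S" "\<forall>(a, b)\<in>S. (\<forall>i. a $ i \<in> \<rat>) \<and> b \<in> \<rat>"
  shows "\<exists>a b. \<forall>x. x \<in> pol S \<longleftrightarrow> (\<forall>j<card S. lvec ord (a j) \<bullet> x \<le> real_of_int (b j))"
proof -
  obtain h where h: "bij_betw h {0..<card S} S"
    using ex_bij_betw_nat_finite[OF assms(1)] by blast
  have "\<exists>a b. \<forall>x. fst s \<bullet> x \<le> snd s \<longleftrightarrow> lvec ord a \<bullet> x \<le> real_of_int b" if "s \<in> S" for s
    using assms(2) that by (intro rational_halfspace_integer) auto
  then obtain a b where ab: "\<And>s x. s \<in> S \<Longrightarrow> fst s \<bullet> x \<le> snd s \<longleftrightarrow> lvec ord (a s) \<bullet> x \<le> real_of_int (b s)"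
    by metis
  have "x \<in> pol S \<longleftrightarrow> (\<forall>j<card S. lvec ord (a (h j)) \<bullet> x \<le> real_of_int (b (h j)))" for x
  proof -
    have "x \<in> pol S \<longleftrightarrow> (\<forall>s\<in>S. lvec ord (a s) \<bullet> x \<le> real_of_int (b s))"
      using ab by (auto simp: pol_def case_prod_beta)
    moreover have "(\<forall>s\<in>h ` {..<card S}. lvec ord (a s) \<bullet> x \<le> real_of_int (b s))
        \<longleftrightarrow> (\<forall>j<card S. lvec ord (a (h j)) \<bullet> x \<le> real_of_int (b (h j)))" by auto
    moreover have "h ` {..<card S} = S" using h by (simp add: bij_betw_def atLeast0LessThan)
    ultimately show ?thesis by simp
  qed
  then show ?thesis by (intro exI[of _ "\<lambda>j. a (h j)"] exI[of _ "\<lambda>j. b (h j)"]) blast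
qed

end

section \<open>Soundness and completeness of the certificates\<close>

context
  fixes ord :: "'n::finite \<Rightarrow> nat" and X :: "(real^'n) set" and E :: nat
  assumes ord: "bij_betw ord UNIV {..<CARD('n)}"
    and X: "X = (\<lambda>l. lvec ord (pt E l)) ` {..<llen E}"
    and full: "aff_dim X = int CARD('n)"
    and conv: "lattice_convex X"
begin

lemma is_pt_iff: "is_pt CARD('n) E g \<longleftrightarrow> lvec ord g \<in> X"
proof -
  have "(\<forall>i<CARD('n). pt E l i = g i) \<longleftrightarrow> lvec ord g = lvec ord (pt E l)" for l
    unfolding lvec_eq_iff[OF ord] by (auto simp: eq_commute)
  then show ?thesis by (auto simp: is_pt_def X)
qed

lemma finite_X: "finite X"
  by (simp add: X)

lemma lattice_X: "X \<subseteq> int_lattice"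
  using conv by (auto simp: lattice_convex_def)

lemma nonempty_X: "X \<noteq> {}"
  using full by auto

section \<open>Certificates for the upper bound\<close>

lemma rc_le_cert_sound:
  assumes "rc_le_cert CARD('n) E k W"
  shows "rc X \<le> k"
proof -
  let ?d = "CARD('n)"
  obtain s where
    valid: "\<forall>l<llen E. \<forall>j<k. (\<Sum>i<?d. sdigit W s (j * Suc ?d + i) * pt E l i) \<le> sdigit W s (j * Suc ?d + ?d)"
    and cut: "\<forall>y<(2 * W + 1) ^ ?d. is_pt ?d E (sdigit W y) \<or>
        (\<exists>j<k. sdigit W s (j * Suc ?d + ?d) < (\<Sum>i<?d. sdigit W s (j * Suc ?d + i) * sdigit W y i))"
    and bounded: "\<forall>i<?d. \<forall>e<2. \<exists>r<Suc W ^ k. \<exists>m<Suc W. 0 < m \<and>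
        (\<forall>h<?d. (\<Sum>j<k. int (digit (Suc W) r j) * sdigit W s (j * Suc ?d + h))
           = int m * (if h = i then 1 - 2 * int e else 0)) \<and>
        (\<Sum>j<k. int (digit (Suc W) r j) * sdigit W s (j * Suc ?d + ?d)) \<le> int m * int W"
    using assms unfolding rc_le_cert_def by blast
  define a where "a j i = sdigit W s (j * Suc ?d + i)" for j i
  define b where "b j = sdigit W s (j * Suc ?d + ?d)" for j
  define S where "S = (\<lambda>j. (lvec ord (a j), real_of_int (b j))) ` {..<k}"
  have pol_lvec: "lvec ord g \<in> pol S \<longleftrightarrow> (\<forall>j<k. (\<Sum>i<?d. a j i * g i) \<le> b j)" for g
    by (auto simp: pol_def S_def inner_lvec[OF ord] simp del: of_int_sum)
  have box: "lvec ord g \<in> box W" if g: "\<And>j. j < k \<Longrightarrow> (\<Sum>i<?d. a j i * g i) \<le> b j" for g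
  proof -
    \<comment> \<open>Combining the rows with the multipliers isolates one coordinate with a sign.
      The cases e = 0 and e = 1 bound it from above and from below.\<close>
    have signed: "(1 - 2 * int e) * g i \<le> int W" if i: "i < ?d" and e: "e < 2" for i e
    proof -
      obtain r m where m: "0 < m"
        and comb: "\<forall>h<?d. (\<Sum>j<k. int (digit (Suc W) r j) * a j h) = int m * (if h = i then 1 - 2 * int e else 0)"
        and rhs: "(\<Sum>j<k. int (digit (Suc W) r j) * b j) \<le> int m * int W"
        using bounded i e unfolding a_def b_def by blast
      have "int m * ((1 - 2 * int e) * g i)
          = (\<Sum>h<?d. int m * (if h = i then 1 - 2 * int e else 0) * g h)"
        using i by (simp add: if_distrib if_distribR cong: if_cong)
      also have "\<dots> = (\<Sum>h<?d. (\<Sum>j<k. int (digit (Suc W) r j) * a j h) * g h)"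
        using comb by (intro sum.cong) auto
      also have "\<dots> = (\<Sum>j<k. int (digit (Suc W) r j) * (\<Sum>h<?d. a j h * g h))"
        unfolding sum_distrib_left sum_distrib_right by (subst sum.swap) (simp add: mult.assoc)
      also have "\<dots> \<le> (\<Sum>j<k. int (digit (Suc W) r j) * b j)"
        by (intro sum_mono mult_left_mono) (auto simp: g)
      also have "\<dots> \<le> int m * int W" by (rule rhs)
      finally show ?thesis using m by simp
    qed
    have "\<bar>g i\<bar> \<le> int W" if "i < ?d" for i
      using signed[OF that, of 0] signed[OF that, of 1] by simp
    then have "\<bar>real_of_int (g (ord i))\<bar> \<le> real W" for i
      using ord_less[OF ord, of i] by (metis of_int_abs of_int_le_iff of_int_of_nat_eq)
    then show ?thesis
      using lvec_ord_in_int_lattice by (auto simp: box_def lvec_def)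
  qed
  have "pol S \<inter> int_lattice = X"
  proof (intro equalityI subsetI)
    fix z assume z: "z \<in> pol S \<inter> int_lattice"
    then obtain g where g: "z = lvec ord g" using int_lattice_eq[OF ord] by blast
    have le: "\<And>j. j < k \<Longrightarrow> (\<Sum>i<?d. a j i * g i) \<le> b j" using z pol_lvec unfolding g by blast
    from box[OF le] obtain y where y: "y < (2 * W + 1) ^ ?d" "z = lvec ord (sdigit W y)"
      unfolding g box_eq_grid[OF ord] by blast
    have "(\<Sum>i<?d. a j i * sdigit W y i) \<le> b j" if "j < k" for j
      using that z pol_lvec unfolding y(2) by blast
    then have "is_pt ?d E (sdigit W y)"
      using cut y(1) unfolding a_def b_def not_less[symmetric] by blast
    then show "z \<in> X" unfolding is_pt_iff y(2) .
  next
    fix z assume "z \<in> X"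
    then obtain l where l: "l < llen E" "z = lvec ord (pt E l)" using X by auto
    have "z \<in> pol S" unfolding l(2) pol_lvec using valid l(1) by (simp add: a_def b_def)
    then show "z \<in> pol S \<inter> int_lattice" using lattice_X \<open>z \<in> X\<close> by blast
  qed
  then have "rc X \<le> card S" using full by (intro rc_le_card) (auto simp: S_def)
  also have "\<dots> \<le> k" unfolding S_def using card_image_le[of "{..<k}"] by auto
  finally show ?thesis .
qed

text \<open>The system describes \<open>X\<close> on the whole lattice, so its rows are valid and
  cut off the remaining points of every box, whatever \<open>W\<close> is. Only the coefficients,
  the multipliers and the combined right-hand sides force \<open>W\<close> to be large, and these
  are finitely many numbers.\<close>

lemma rc_le_cert_complete:
  fixes a :: "nat \<Rightarrow> nat \<Rightarrow> int" and b :: "nat \<Rightarrow> int"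
  assumes sys: "\<And>x. x \<in> X \<longleftrightarrow> x \<in> int_lattice \<and> (\<forall>j<k. lvec ord (a j) \<bullet> x \<le> real_of_int (b j))"
  shows "\<forall>\<^sub>F W in sequentially. rc_le_cert CARD('n) E k W"
proof -
  let ?d = "CARD('n)"
  have X_iff: "lvec ord g \<in> X \<longleftrightarrow> (\<forall>j<k. (\<Sum>i<?d. a j i * g i) \<le> b j)" for g
    unfolding sys by (simp add: inner_lvec[OF ord] lvec_ord_in_int_lattice del: of_int_sum)
  \<comment> \<open>A nonzero integral recession direction would generate infinitely many points of
    the finite set \<open>X\<close> from a single one. So zero is the only integral test vector in
    \<open>Farkas_integer\<close>, whose hypothesis then holds for every signed unit vector.\<close>
  have recession: "p i = 0" if p: "\<And>j. j < k \<Longrightarrow> (\<Sum>i<?d. a j i * p i) \<le> 0" and i: "i < ?d" for p i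
  proof (rule ccontr)
    assume nz: "p i \<noteq> 0"
    obtain z where z: "z \<in> X" using nonempty_X by blast
    then obtain g where "z = lvec ord g" using lattice_X int_lattice_eq[OF ord] by blast
    with z have g: "lvec ord g \<in> X" by simp
    have "lvec ord (\<lambda>h. g h + int n * p h) \<in> X" for n :: nat
      unfolding X_iff
    proof (intro allI impI)
      fix j assume j: "j < k"
      have "(\<Sum>i<?d. a j i * (g i + int n * p i)) = (\<Sum>i<?d. a j i * g i) + int n * (\<Sum>i<?d. a j i * p i)"
        by (simp add: algebra_simps sum.distrib sum_distrib_left)
      also have "\<dots> \<le> b j + int n * 0"
        using g j p[OF j] unfolding X_iff by (intro add_mono mult_left_mono) auto
      finally show "(\<Sum>i<?d. a j i * (g i + int n * p i)) \<le> b j" by simp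
    qed
    then have "range (\<lambda>n::nat. lvec ord (\<lambda>h. g h + int n * p h)) \<subseteq> X" by blast
    then have "finite (range (\<lambda>n::nat. lvec ord (\<lambda>h. g h + int n * p h)))"
      using finite_X finite_subset by blast
    moreover have "inj (\<lambda>n::nat. lvec ord (\<lambda>h. g h + int n * p h))"
      using i nz by (intro injI) (auto simp: lvec_eq_iff[OF ord])
    ultimately show False using finite_imageD infinite_UNIV_nat by blast
  qed
  define unit :: "nat \<Rightarrow> nat \<Rightarrow> nat \<Rightarrow> int" where "unit i e h = (if h = i then 1 - 2 * int e else 0)" for i e h
  have "\<exists>r m. 0 < m \<and> (\<forall>h<?d. (\<Sum>j<k. int (r j) * a j h) = int m * unit i e h)" if i: "i < ?d" for i e
  proof (rule Farkas_integer[OF ord])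
    fix p assume "\<And>j. j < k \<Longrightarrow> (\<Sum>h<?d. a j h * p h) \<le> 0"
    from recession[OF this] show "(\<Sum>h<?d. unit i e h * p h) \<le> 0" by simp
  qed
  then have "\<forall>i e. \<exists>r m. i < ?d \<longrightarrow> 0 < m \<and> (\<forall>h<?d. (\<Sum>j<k. int (r j) * a j h) = int m * unit i e h)"
    by meson
  then obtain r m where "\<forall>i e. i < ?d \<longrightarrow> 0 < m i e \<and> (\<forall>h<?d. (\<Sum>j<k. int (r i e j) * a j h) = int (m i e) * unit i e h)"
    unfolding choice_iff by blast
  then have m: "\<And>i e. i < ?d \<Longrightarrow> 0 < m i e"
    and comb: "\<And>i e h. i < ?d \<Longrightarrow> h < ?d \<Longrightarrow>
      (\<Sum>j<k. int (r i e j) * a j h) = int (m i e) * unit i e h" by simp_all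
  have ev: "\<forall>\<^sub>F W in sequentially. x \<le> int W" for x
    using eventually_ge_at_top[of "nat x"] by eventually_elim simp
  have ev': "\<forall>\<^sub>F W in sequentially. x < Suc W" for x :: nat
    using eventually_ge_at_top[of x] by eventually_elim simp
  have "\<forall>\<^sub>F W in sequentially. (\<forall>j\<in>{..<k}. \<bar>b j\<bar> \<le> int W \<and> (\<forall>i\<in>{..<?d}. \<bar>a j i\<bar> \<le> int W)) \<and>
    (\<forall>i\<in>{..<?d}. \<forall>e\<in>{..<2::nat}. m i e < Suc W \<and> (\<forall>j\<in>{..<k}. r i e j < Suc W)
      \<and> (\<Sum>j<k. int (r i e j) * b j) \<le> int W)"
    by (intro eventually_conj eventually_ball_finite ballI ev ev' finite_lessThan)
  then show ?thesis
  proof eventually_elim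
    case (elim W)
    \<comment> \<open>The table of rows written as one sequence: with blocks of length d + 1, the
      last entry of each block is the right-hand side.\<close>
    define v where "v q = (if q mod Suc ?d < ?d then a (q div Suc ?d) (q mod Suc ?d) else b (q div Suc ?d))" for q
    have "\<bar>v q\<bar> \<le> int W" if "q < k * Suc ?d" for q
      using that elim less_mult_imp_div_less[OF that] by (auto simp: v_def)
    then obtain s where s: "s < (2 * W + 1) ^ (k * Suc ?d)" "\<forall>q<k * Suc ?d. sdigit W s q = v q"
      using sdigit_exist by blast
    have idx: "j * Suc ?d + i < k * Suc ?d" if "j < k" "i < Suc ?d" for j i
    proof -
      have "j * Suc ?d + i < Suc j * Suc ?d" using that by simp
      also have "\<dots> \<le> k * Suc ?d" using that by (intro mult_le_mono1) simp
      finally show ?thesis .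
    qed
    have sa: "sdigit W s (j * Suc ?d + i) = a j i" if "j < k" "i < ?d" for j i
    proof -
      have "(j * Suc ?d + i) mod Suc ?d = i" "(j * Suc ?d + i) div Suc ?d = j"
        using that div_mult_self3[of "Suc ?d" j i] mod_mult_self3[of j "Suc ?d" i] by (simp_all del: mult_Suc_right)
      then show ?thesis using s(2) idx[of j i] that by (simp add: v_def del: mult_Suc_right)
    qed
    have sb: "sdigit W s (j * Suc ?d + ?d) = b j" if "j < k" for j
    proof -
      have "(j * Suc ?d + ?d) mod Suc ?d = ?d" "(j * Suc ?d + ?d) div Suc ?d = j"
        using div_mult_self3[of "Suc ?d" j ?d] mod_mult_self3[of j "Suc ?d" ?d] by (simp_all del: mult_Suc_right)
      then show ?thesis using s(2) idx[of j ?d] that by (simp add: v_def del: mult_Suc_right)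
    qed
    have row: "(\<Sum>i<?d. sdigit W s (j * Suc ?d + i) * g i) = (\<Sum>i<?d. a j i * g i)" if "j < k" for j g
      using sa[OF that] by (intro sum.cong) auto
    show ?case
      unfolding rc_le_cert_def
    proof (rule exI[of _ s], intro conjI allI impI)
      show "s < (2 * W + 1) ^ (k * Suc ?d)" by (rule s(1))
      fix l j assume l: "l < llen E" and j: "j < k"
      have "lvec ord (pt E l) \<in> X" using l X by blast
      then show "(\<Sum>i<?d. sdigit W s (j * Suc ?d + i) * pt E l i) \<le> sdigit W s (j * Suc ?d + ?d)"
        using j unfolding row[OF j] sb[OF j] X_iff by blast
    next
      fix y assume "y < (2 * W + 1) ^ ?d"
      show "is_pt ?d E (sdigit W y) \<or>
        (\<exists>j<k. sdigit W s (j * Suc ?d + ?d) < (\<Sum>i<?d. sdigit W s (j * Suc ?d + i) * sdigit W y i))"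
        unfolding is_pt_iff X_iff using row sb by (metis not_less)
    next
      fix i e :: nat assume i: "i < ?d" and e: "e < 2"
      have small: "m i e < Suc W" "\<And>j. j < k \<Longrightarrow> r i e j < Suc W" "(\<Sum>j<k. int (r i e j) * b j) \<le> int W"
        using elim i e by auto
      obtain R where R: "R < Suc W ^ k" "\<forall>j<k. digit (Suc W) R j = r i e j"
        using digits_exist[of k "r i e" "Suc W", OF small(2)] by blast
      \<comment> \<open>As the multiplier \<open>m i e\<close> is at least 1, a right-hand side
        bounded by W is also bounded by the multiple of W that the certificate allows.\<close>
      have "int W * 1 \<le> int W * int (m i e)" using m[OF i, of e] by (intro mult_left_mono) auto
      then have "(\<Sum>j<k. int (r i e j) * b j) \<le> int (m i e) * int W" using small(3) by (simp add: mult.commute)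
      then have rhs: "(\<Sum>j<k. int (digit (Suc W) R j) * sdigit W s (j * Suc ?d + ?d)) \<le> int (m i e) * int W"
        using R(2) sb by simp
      have comb': "(\<Sum>j<k. int (digit (Suc W) R j) * sdigit W s (j * Suc ?d + h))
           = int (m i e) * unit i e h" if h: "h < ?d" for h
        unfolding comb[OF i h, symmetric] using R(2) sa[OF _ h] by (intro sum.cong) auto
      show "\<exists>r<Suc W ^ k. \<exists>m<Suc W. 0 < m \<and>
        (\<forall>h<?d. (\<Sum>j<k. int (digit (Suc W) r j) * sdigit W s (j * Suc ?d + h))
           = int m * (if h = i then 1 - 2 * int e else 0)) \<and>
        (\<Sum>j<k. int (digit (Suc W) r j) * sdigit W s (j * Suc ?d + ?d)) \<le> int m * int W"
        unfolding unit_def[symmetric]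
        using R(1) small(1) m[OF i, of e] comb' rhs by (intro exI[of _ R] exI[of _ "m i e"] conjI) simp_all
    qed
  qed
qed

section \<open>Certificates for the lower bound\<close>

text \<open>A separating system with fewer than k rows would assign to each outside point of the box
  a row that it violates. The certificate applied to this assignment yields a class and a common
  convex combination of it and of \<open>X\<close>; there the row of that class is satisfied and
  violated at once.\<close>

lemma rc_ge_cert_sound:
  assumes cert: "rc_ge_cert CARD('n) E k t W"
  shows "k \<le> rc X"
proof -
  let ?d = "CARD('n)" and ?B = "(2 * t + 1) ^ CARD('n)"
  obtain S where S: "finite S" "card S = rc_rel X (box t)" "\<forall>x\<in>X. \<forall>(a, b)\<in>S. a \<bullet> x \<le> b"
    "\<forall>y\<in>box t - X. \<exists>(a, b)\<in>S. a \<bullet> y > b"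
    using rc_rel_attained[OF full finite_X conv, of "box t"] by (auto simp: box_def)
  have "k \<le> card S"
  proof (rule ccontr)
    assume less: "\<not> k \<le> card S"
    obtain h where h: "bij_betw h {0..<card S} S"
      using ex_bij_betw_nat_finite[OF S(1)] by blast
    define viol where "viol y = (SOME j. j < card S \<and> snd (h j) < fst (h j) \<bullet> lvec ord (sdigit t y))" for y
    have viol: "viol y < card S \<and> snd (h (viol y)) < fst (h (viol y)) \<bullet> lvec ord (sdigit t y)"
      if y: "y < ?B" "\<not> is_pt ?d E (sdigit t y)" for y
    proof -
      have "lvec ord (sdigit t y) \<in> box t - X"
        using y by (auto simp: box_eq_grid[OF ord] is_pt_iff)
      then have "\<exists>(a, b)\<in>S. a \<bullet> lvec ord (sdigit t y) > b" by (rule bspec[OF S(4)])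
      then obtain s where "s \<in> S" "snd s < fst s \<bullet> lvec ord (sdigit t y)" by (auto simp: case_prod_beta)
      moreover have "s \<in> h ` {0..<card S}" using h \<open>s \<in> S\<close> by (simp add: bij_betw_def)
      ultimately have "\<exists>j. j < card S \<and> snd (h j) < fst (h j) \<bullet> lvec ord (sdigit t y)" by auto
      then show ?thesis unfolding viol_def by (rule someI_ex)
    qed
    \<comment> \<open>Points of \<open>X\<close> get the arbitrary class 0, which the certificate
      ignores. Violated rows have indices below \<open>card S\<close>, hence below k - 1 or less
      than k in any case, so the class k - 1 is never assigned to an outside point.\<close>
    have "(if is_pt ?d E (sdigit t y) then 0 else viol y) < k" if "y < ?B" for y
      using viol[OF that] less by auto
    from digits_exist[of ?B "\<lambda>y. if is_pt ?d E (sdigit t y) then 0 else viol y" k, OF this]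
    obtain f where f: "f < k ^ ?B"
      and fy: "\<And>y. y < ?B \<Longrightarrow> digit k f y = (if is_pt ?d E (sdigit t y) then 0 else viol y)"
      by blast
    have "\<not> (\<exists>y<?B. \<not> is_pt ?d E (sdigit t y) \<and> Suc (digit k f y) = k)"
    proof
      assume "\<exists>y<?B. \<not> is_pt ?d E (sdigit t y) \<and> Suc (digit k f y) = k"
      then obtain y where y: "y < ?B" "\<not> is_pt ?d E (sdigit t y)" "Suc (digit k f y) = k" by blast
      then have "digit k f y = viol y" using fy by simp
      then show False using viol[OF y(1,2)] y(3) less by simp
    qed
    with mp[OF spec[OF cert[unfolded rc_ge_cert_def]] f] obtain c r s where
      supp: "\<forall>y<?B. 0 < digit (Suc W) s y \<longrightarrow> \<not> is_pt ?d E (sdigit t y) \<and> digit k f y = c"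
      and pos: "0 < (\<Sum>l<llen E. digit (Suc W) r l)"
      and sums: "(\<Sum>l<llen E. digit (Suc W) r l) = (\<Sum>y<?B. digit (Suc W) s y)"
      and comb: "\<forall>i<?d. (\<Sum>l<llen E. int (digit (Suc W) r l) * pt E l i)
           = (\<Sum>y<?B. int (digit (Suc W) s y) * sdigit t y i)"
      by blast
    define \<rho> where "\<rho> l = real (digit (Suc W) r l)" for l
    define \<sigma> where "\<sigma> y = real (digit (Suc W) s y)" for y
    \<comment> \<open>A grid point of positive weight makes the final estimate strict. It also
      identifies \<open>c\<close> as the index of an actual row of \<open>S\<close>.\<close>
    have "\<exists>y<?B. 0 < digit (Suc W) s y"
    proof (rule ccontr)
      assume "\<not> ?thesis"
      then have "(\<Sum>y<?B. digit (Suc W) s y) = 0" by (intro sum.neutral) auto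
      then show False using pos sums by simp
    qed
    then obtain y0 where y0: "y0 < ?B" "0 < digit (Suc W) s y0" by blast
    have vc: "viol y = c" if "y < ?B" "0 < digit (Suc W) s y" for y
      using supp[rule_format, OF that] fy[OF that(1)] by auto
    have c: "c < card S" using vc[OF y0] viol[OF y0(1)] supp y0 by blast
    define a b where "a = fst (h c)" and "b = snd (h c)"
    have "h c \<in> S" using c h by (auto simp: bij_betw_def)
    then have aX: "a \<bullet> x \<le> b" if "x \<in> X" for x
      using S(3) that unfolding a_def b_def by fastforce
    have "(\<Sum>l<llen E. \<rho> l *\<^sub>R lvec ord (pt E l)) = (\<Sum>y<?B. \<sigma> y *\<^sub>R lvec ord (sdigit t y))"
    proof (subst vec_eq_iff, intro allI)
      fix i
      have "real_of_int (\<Sum>l<llen E. int (digit (Suc W) r l) * pt E l (ord i))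
          = real_of_int (\<Sum>y<?B. int (digit (Suc W) s y) * sdigit t y (ord i))"
        using comb ord_less[OF ord] by simp
      then show "(\<Sum>l<llen E. \<rho> l *\<^sub>R lvec ord (pt E l)) $ i = (\<Sum>y<?B. \<sigma> y *\<^sub>R lvec ord (sdigit t y)) $ i"
        by (simp add: lvec_def \<rho>_def \<sigma>_def)
    qed
    then have "a \<bullet> (\<Sum>l<llen E. \<rho> l *\<^sub>R lvec ord (pt E l)) = a \<bullet> (\<Sum>y<?B. \<sigma> y *\<^sub>R lvec ord (sdigit t y))"
      by (rule arg_cong)
    then have eq: "(\<Sum>l<llen E. \<rho> l * (a \<bullet> lvec ord (pt E l))) = (\<Sum>y<?B. \<sigma> y * (a \<bullet> lvec ord (sdigit t y)))"
      by (simp add: inner_sum_right)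
    have "(\<Sum>l<llen E. \<rho> l * (a \<bullet> lvec ord (pt E l))) \<le> (\<Sum>l<llen E. \<rho> l * b)"
      by (intro sum_mono mult_left_mono aX) (auto simp: X \<rho>_def)
    also have "\<dots> = real (\<Sum>l<llen E. digit (Suc W) r l) * b"
      by (simp add: \<rho>_def sum_distrib_right)
    also have "\<dots> = (\<Sum>y<?B. \<sigma> y * b)"
      unfolding sums by (simp add: \<sigma>_def sum_distrib_right)
    also have "\<dots> < (\<Sum>y<?B. \<sigma> y * (a \<bullet> lvec ord (sdigit t y)))"
    proof (rule sum_strict_mono_ex1)
      have le: "\<sigma> y * b < \<sigma> y * (a \<bullet> lvec ord (sdigit t y))" if "y < ?B" "0 < digit (Suc W) s y" for y
        using viol[OF that(1)] supp vc[OF that] that unfolding a_def b_def \<sigma>_def by auto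
      show "\<forall>y\<in>{..<?B}. \<sigma> y * b \<le> \<sigma> y * (a \<bullet> lvec ord (sdigit t y))"
        using le by (fastforce simp: \<sigma>_def)
      show "\<exists>y\<in>{..<?B}. \<sigma> y * b < \<sigma> y * (a \<bullet> lvec ord (sdigit t y))"
        using le[OF y0] y0(1) by blast
    qed simp
    finally show False using eq by simp
  qed
  also have "card S \<le> rc X"
    unfolding S(2) by (rule rc_rel_le_rc[OF full finite_X conv]) (auto simp: box_def)
  finally show ?thesis .
qed

text \<open>If for some assignment every class had a hull disjoint from that of \<open>X\<close>,
  one hyperplane per class would give a separating system with only k - 1 rows. There are finitely
  many assignments, so the witnesses for all of them fit under one bound.\<close>

lemma rc_ge_cert_complete:
  assumes k: "k \<le> rc_rel X (box t)"
  shows "\<forall>\<^sub>F W in sequentially. rc_ge_cert CARD('n) E k t W"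
proof -
  let ?d = "CARD('n)" and ?B = "(2 * t + 1) ^ CARD('n)"
  have ev': "\<forall>\<^sub>F W in sequentially. x < Suc W" for x :: nat
    using eventually_ge_at_top[of x] by eventually_elim simp
  have "\<forall>\<^sub>F W in sequentially. \<forall>f\<in>{..<k ^ ?B}.
     (\<exists>y<?B. \<not> is_pt ?d E (sdigit t y) \<and> Suc (digit k f y) = k) \<or>
     (\<exists>c<k - 1. \<exists>r<Suc W ^ llen E. \<exists>s<Suc W ^ ?B.
        (\<forall>y<?B. 0 < digit (Suc W) s y \<longrightarrow> \<not> is_pt ?d E (sdigit t y) \<and> digit k f y = c) \<and>
        0 < (\<Sum>l<llen E. digit (Suc W) r l) \<and>
        (\<Sum>l<llen E. digit (Suc W) r l) = (\<Sum>y<?B. digit (Suc W) s y) \<and>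
        (\<forall>i<?d. (\<Sum>l<llen E. int (digit (Suc W) r l) * pt E l i)
           = (\<Sum>y<?B. int (digit (Suc W) s y) * sdigit t y i)))"
  proof (intro eventually_ball_finite ballI finite_lessThan)
    fix f assume f: "f \<in> {..<k ^ ?B}"
    \<comment> \<open>The grid has at least one point, so for k = 0 there is no assignment at all
      and nothing has to be shown.\<close>
    have k0: "k > 0"
    proof (rule ccontr)
      assume "\<not> k > 0"
      moreover have "k ^ ?B \<noteq> 0" using f by (metis lessThan_iff not_less_zero)
      ultimately show False by (simp add: power_0_left)
    qed
    show "\<forall>\<^sub>F W in sequentially. (\<exists>y<?B. \<not> is_pt ?d E (sdigit t y) \<and> Suc (digit k f y) = k) \<or>
     (\<exists>c<k - 1. \<exists>r<Suc W ^ llen E. \<exists>s<Suc W ^ ?B.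
        (\<forall>y<?B. 0 < digit (Suc W) s y \<longrightarrow> \<not> is_pt ?d E (sdigit t y) \<and> digit k f y = c) \<and>
        0 < (\<Sum>l<llen E. digit (Suc W) r l) \<and>
        (\<Sum>l<llen E. digit (Suc W) r l) = (\<Sum>y<?B. digit (Suc W) s y) \<and>
        (\<forall>i<?d. (\<Sum>l<llen E. int (digit (Suc W) r l) * pt E l i)
           = (\<Sum>y<?B. int (digit (Suc W) s y) * sdigit t y i)))"
      (is "\<forall>\<^sub>F W in sequentially. ?un \<or> ?meet W")
    proof (cases ?un)
      case False
      define Y where "Y c = {y. y < ?B \<and> \<not> is_pt ?d E (sdigit t y) \<and> digit k f y = c}" for c
      have finY: "finite (Y c)" for c by (simp add: Y_def)
      have "\<exists>c<k - 1. convex hull X \<inter> convex hull ((\<lambda>y. lvec ord (sdigit t y)) ` Y c) \<noteq> {}"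
      proof (rule ccontr)
        assume "\<not> ?thesis"
        then have disj: "convex hull X \<inter> convex hull ((\<lambda>y. lvec ord (sdigit t y)) ` Y c) = {}" if "c < k - 1" for c
          using that by blast
        \<comment> \<open>A class may be empty; compactness and nonemptiness are asked only of the
          hull of \<open>X\<close>.\<close>
        have "\<exists>a b. (\<forall>x\<in>convex hull X. a \<bullet> x < b) \<and>
            (\<forall>y\<in>convex hull ((\<lambda>y. lvec ord (sdigit t y)) ` Y c). a \<bullet> y > b)" if "c < k - 1" for c
          using finite_X finY nonempty_X disj[OF that]
          by (intro separating_hyperplane_compact_closed)
            (auto simp: finite_imp_compact_convex_hull compact_imp_closed)
        then obtain a b where ab: "\<And>c x. c < k - 1 \<Longrightarrow> x \<in> convex hull X \<Longrightarrow> a c \<bullet> x < b c"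
          "\<And>c y. c < k - 1 \<Longrightarrow> y \<in> convex hull ((\<lambda>y. lvec ord (sdigit t y)) ` Y c) \<Longrightarrow> a c \<bullet> y > b c"
          by metis
        define S where "S = (\<lambda>c. (a c, b c)) ` {..<k - 1}"
        have "rc_rel X (box t) \<le> card S"
        proof (rule rc_rel_le_card)
          show "finite S" by (simp add: S_def)
          show "\<forall>x\<in>X. \<forall>(a, b)\<in>S. a \<bullet> x \<le> b"
            using ab(1) hull_inc[of _ X] by (fastforce simp: S_def)
          show "\<forall>y\<in>box t - X. \<exists>(a, b)\<in>S. a \<bullet> y > b"
          proof
            fix z assume z: "z \<in> box t - X"
            then obtain y where y: "y < ?B" "z = lvec ord (sdigit t y)"
              unfolding box_eq_grid[OF ord] by blast
            have np: "\<not> is_pt ?d E (sdigit t y)" using z by (simp add: is_pt_iff y(2))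
            have "digit k f y < k" by (rule digit_less[OF k0])
            moreover have "Suc (digit k f y) \<noteq> k" using False y(1) np by blast
            ultimately have c: "digit k f y < k - 1" by simp
            have "y \<in> Y (digit k f y)" using y(1) np by (simp add: Y_def)
            then have "a (digit k f y) \<bullet> z > b (digit k f y)"
              using c by (intro ab(2) hull_inc) (auto simp: y(2))
            then show "\<exists>(a, b)\<in>S. a \<bullet> z > b" using c by (auto simp: S_def)
          qed
        qed
        also have "card S \<le> k - 1" unfolding S_def using card_image_le[of "{..<k - 1}"] by auto
        finally show False using k k0 by simp
      qed
      then obtain c where c: "c < k - 1"
        and meet: "convex hull ((\<lambda>l. lvec ord (pt E l)) ` {..<llen E})
          \<inter> convex hull ((\<lambda>y. lvec ord (sdigit t y)) ` Y c) \<noteq> {}"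
        unfolding X by blast
      obtain r s where pos: "0 < sum r {..<llen E}" and sums: "sum r {..<llen E} = sum s (Y c)"
        and comb: "\<And>i. i < ?d \<Longrightarrow> (\<Sum>l<llen E. int (r l) * pt E l i) = (\<Sum>y\<in>Y c. int (s y) * sdigit t y i)"
        by (rule hulls_meet_integer[OF ord finite_lessThan finY meet]) blast
      \<comment> \<open>The certificate sums over the whole grid, so the weights are extended by
        zero outside the class.\<close>
      define s' where "s' y = (if y \<in> Y c then s y else 0)" for y
      have YB: "Y c \<subseteq> {..<?B}" by (auto simp: Y_def)
      have sum_s': "sum s (Y c) = (\<Sum>y<?B. s' y)"
        "(\<Sum>y\<in>Y c. int (s y) * sdigit t y i) = (\<Sum>y<?B. int (s' y) * sdigit t y i)" for i
        by (intro sum.mono_neutral_cong_left; use YB in \<open>auto simp: s'_def\<close>)+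
      have "\<forall>\<^sub>F W in sequentially. (\<forall>l\<in>{..<llen E}. r l < Suc W) \<and> (\<forall>y\<in>{..<?B}. s' y < Suc W)"
        by (intro eventually_conj eventually_ball_finite ballI ev' finite_lessThan)
      then show ?thesis
      proof eventually_elim
        case (elim W)
        then obtain R where R: "R < Suc W ^ llen E" "\<forall>l<llen E. digit (Suc W) R l = r l"
          using digits_exist[of "llen E" r "Suc W"] by auto
        obtain T where T: "T < Suc W ^ ?B" "\<forall>y<?B. digit (Suc W) T y = s' y"
          using elim digits_exist[of ?B s' "Suc W"] by auto
        have "\<forall>y<?B. 0 < digit (Suc W) T y \<longrightarrow> \<not> is_pt ?d E (sdigit t y) \<and> digit k f y = c"
          using T(2) by (auto simp: s'_def Y_def)
        moreover have "(\<Sum>l<llen E. digit (Suc W) R l) = sum r {..<llen E}"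
          "(\<Sum>y<?B. digit (Suc W) T y) = (\<Sum>y<?B. s' y)"
          using R(2) T(2) by auto
        moreover have "(\<Sum>l<llen E. int (digit (Suc W) R l) * pt E l i) = (\<Sum>l<llen E. int (r l) * pt E l i)"
          "(\<Sum>y<?B. int (digit (Suc W) T y) * sdigit t y i) = (\<Sum>y<?B. int (s' y) * sdigit t y i)" for i
          using R(2) T(2) by auto
        ultimately have "?meet W"
          using c R(1) T(1) pos sums comb sum_s'
          by (intro exI[of _ c] exI[of _ R] exI[of _ T] conjI) auto
        then show ?case ..
      qed
    qed simp
  qed
  then show ?thesis by eventually_elim (auto simp: rc_ge_cert_def)
qed

section \<open>Existence of a certificate and the algorithm\<close>

lemma rc_cert_sound: "rc_cert CARD('n) E N \<Longrightarrow> pfst N = rc X"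
  using rc_le_cert_sound rc_ge_cert_sound by (auto simp: rc_cert_def intro: antisym)

lemma rc_cert_exists:
  assumes "rc_l X = rc_Q X"
  shows "\<exists>N. rc_cert CARD('n) E N"
proof -
  note ex = rational_polyhedron_exists[OF ord finite_X conv]
  have rc: "rc X = rc_Q X"
    by (rule rc_eq_rc_Q[OF full finite_X conv assms ex])
  obtain t where "rc_rel X (box t) = rc_l X"
    using rc_l_attained[OF full finite_X conv] by blast
  then have ge: "\<forall>\<^sub>F W in sequentially. rc_ge_cert CARD('n) E (rc X) t W"
    using rc assms by (intro rc_ge_cert_complete) simp
  obtain S where S: "finite S" "pol S \<inter> int_lattice = X" "card S = rc X"
    "\<forall>(a, b)\<in>S. (\<forall>i. a $ i \<in> \<rat>) \<and> b \<in> \<rat>"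
    using rc_Q_attained[OF full ex] unfolding rc by blast
  obtain a b where ab: "\<forall>x. x \<in> pol S \<longleftrightarrow> (\<forall>j<rc X. lvec ord (a j) \<bullet> x \<le> real_of_int (b j))"
    using rational_system_integer[OF ord S(1,4)] unfolding S(3) by blast
  have le: "\<forall>\<^sub>F W in sequentially. rc_le_cert CARD('n) E (rc X) W"
    by (rule rc_le_cert_complete[of _ a b]) (use S(2) ab in auto)
  \<comment> \<open>Both halves hold for all large \<open>W\<close>, so a common value exists even
    though their witnesses are unrelated.\<close>
  obtain W where "rc_le_cert CARD('n) E (rc X) W \<and> rc_ge_cert CARD('n) E (rc X) t W"
    using eventually_happens'[OF sequentially_bot eventually_conj[OF le ge]] by blast
  then have "rc_cert CARD('n) E (pair (rc X) (pair t W))" by (simp add: rc_cert_def)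
  then show ?thesis by blast
qed

end

lemma pt_encode_points:
  assumes "l < length xs" "i < length (xs ! l)"
  shows "pt (encode_points xs) l i = xs ! l ! i"
  using assms by (simp add: pt_def encode_points_def lnth_encode)

lemma llen_encode_points: "llen (encode_points xs) = length xs"
  by (simp add: encode_points_def llen_encode)

theorem theorem2p5:
  fixes ord :: "'n::finite \<Rightarrow> nat"
  assumes "bij_betw ord UNIV {..<CARD('n)}"
  shows "\<exists>p :: recf. \<forall>X :: (real^'n) set.
           finite X \<and> X \<subseteq> int_lattice \<and> lattice_convex X \<and> aff_dim X = int CARD('n)
           \<and> rc_l X = rc_Q X \<longrightarrow>
           (\<forall>xs :: int list list. (\<forall>v\<in>set xs. length v = CARD('n)) \<and> vec_of ord ` set xs = X
              \<longrightarrow> evalf p [encode_points xs] (rc X))"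
proof -
  have "cf pfst" by (intro cf_intros)
  \<comment> \<open>The program is fixed before \<open>X\<close> is given: it depends on the
    dimension only, and the code of the list is its single input.\<close>
  from mu_search[OF cp_rc_cert this] obtain p where
    p: "\<And>E. \<exists>N. rc_cert CARD('n) E N \<Longrightarrow> evalf p [E] (pfst (LEAST N. rc_cert CARD('n) E N))"
    by blast
  show ?thesis
  proof (intro exI[of _ p] allI impI; elim conjE)
    fix X :: "(real^'n) set" and xs :: "int list list"
    assume conv: "lattice_convex X" and full: "aff_dim X = int CARD('n)" and eq: "rc_l X = rc_Q X"
      and len: "\<forall>v\<in>set xs. length v = CARD('n)" and xs: "vec_of ord ` set xs = X"
    let ?E = "encode_points xs"
    have "vec_of ord (xs ! l) = lvec ord (pt ?E l)" if "l < length xs" for l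
      using that len ord_less[OF assms] by (simp add: vec_of_def lvec_def pt_encode_points vec_eq_iff)
    then have "X = (\<lambda>l. lvec ord (pt ?E l)) ` {..<llen ?E}"
      unfolding xs[symmetric] llen_encode_points set_conv_nth by force
    note inst = assms this full conv
    have ex: "\<exists>N. rc_cert CARD('n) ?E N" by (rule rc_cert_exists[OF inst eq])
    from p[OF ex] rc_cert_sound[OF inst LeastI_ex[OF ex]] show "evalf p [?E] (rc X)" by simp
  qed
qed

end
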